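(* Let $A$ be a Cohen--Macaulay local ring of dimension $d\ge 2$, let $\mu_1,\ldots,\mu_{d-2}$ be an $A$-regular sequence such that $(\mu_1,\ldots,\mu_{d-2})$ is a radical ideal, and let $n_1,\ldots,n_{d-2}\ge 2$ be positive integers. Let $R=A/(\mu_1^{n_1},\ldots,\mu_{d-2}^{n_{d-2}})$. Then $R$ is weakly reduced.
   Context: Local rings are Noetherian. For an ideal $K$ of a local ring $(B,\mathfrak m_B)$, the saturation of $K$ is $K^{\mathrm{sat}}=\bigcup_{i\ge 1}(K:_B\mathfrak m_B^i)$. A complete intersection ideal of a local ring is an ideal generated by a regular sequence $x_1,\ldots,x_i$ with $i\ge 1$. A local ring $R$ with nilradical $N$ is weakly reduced if $I^{\mathrm{sat}}+N=(I+N)^{\mathrm{sat}}$ for every complete intersection ideal $I$ of $R$. When $d=2$ the sequence is empty, generating the zero ideal. *)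

theory Defs
  imports "HOL-Algebra.Ideal_Product" "HOL-Algebra.QuotRing" "HOL-Algebra.Ring_Divisibility"
    "HOL-Library.Extended_Nat"
begin

section \<open>Noetherian local rings\<close>

locale local_ring = cring R + noetherian_ring R for R (structure) +
  assumes unique_maximalideal: "\<exists>!M. maximalideal M R"

definition max_ideal :: "('a, 'b) ring_scheme \<Rightarrow> 'a set"
  where "max_ideal R = (THE M. maximalideal M R)"


section \<open>Operations on ideals\<close>

definition ideal_radical :: "('a, 'b) ring_scheme \<Rightarrow> 'a set \<Rightarrow> 'a set"
  where "ideal_radical R I = {x \<in> carrier R. \<exists>n::nat. x [^]\<^bsub>R\<^esub> n \<in> I}"

definition radical_ideal :: "('a, 'b) ring_scheme \<Rightarrow> 'a set \<Rightarrow> bool"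
  where "radical_ideal R I \<longleftrightarrow> ideal I R \<and> ideal_radical R I = I"

definition nilradical :: "('a, 'b) ring_scheme \<Rightarrow> 'a set"
  where "nilradical R = ideal_radical R {\<zero>\<^bsub>R\<^esub>}"

definition ideal_colon :: "('a, 'b) ring_scheme \<Rightarrow> 'a set \<Rightarrow> 'a set \<Rightarrow> 'a set"
  where "ideal_colon R K J = {r \<in> carrier R. \<forall>s\<in>J. r \<otimes>\<^bsub>R\<^esub> s \<in> K}"

text \<open>The power taken in \<^const>\<open>ideals_set\<close>, whose multiplication is \<^const>\<open>ideal_prod\<close>, is the
  ideal power, not the set of elementwise powers.\<close>

definition saturation :: "('a, 'b) ring_scheme \<Rightarrow> 'a set \<Rightarrow> 'a set"
  where "saturation R K =
    (\<Union>i\<in>{1::nat..}. ideal_colon R K (max_ideal R [^]\<^bsub>ideals_set R\<^esub> i))"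


section \<open>Regular sequences\<close>

definition nonzerodivisor :: "('a, 'b) ring_scheme \<Rightarrow> 'a \<Rightarrow> bool"
  where "nonzerodivisor R a \<longleftrightarrow>
    a \<in> carrier R \<and> (\<forall>b\<in>carrier R. a \<otimes>\<^bsub>R\<^esub> b = \<zero>\<^bsub>R\<^esub> \<longrightarrow> b = \<zero>\<^bsub>R\<^esub>)"

text \<open>The last conjunct says that the quotient by the whole sequence is nonzero. The empty sequence
  is regular exactly when \<open>R\<close> is nonzero, and it generates the zero ideal.\<close>

definition regular_sequence :: "('a, 'b) ring_scheme \<Rightarrow> 'a list \<Rightarrow> bool"
  where "regular_sequence R xs \<longleftrightarrow>
    set xs \<subseteq> carrier R \<and>
    (\<forall>k<length xs. let I = Idl\<^bsub>R\<^esub> (set (take k xs))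
      in nonzerodivisor (R Quot I) (I +>\<^bsub>R\<^esub> (xs ! k))) \<and>
    Idl\<^bsub>R\<^esub> (set xs) \<noteq> carrier R"

definition complete_intersection_ideal :: "('a, 'b) ring_scheme \<Rightarrow> 'a set \<Rightarrow> bool"
  where "complete_intersection_ideal R I \<longleftrightarrow>
    (\<exists>xs. xs \<noteq> [] \<and> regular_sequence R xs \<and> I = Idl\<^bsub>R\<^esub> (set xs))"


section \<open>Dimension, depth and the Cohen--Macaulay property\<close>

definition krull_dim :: "('a, 'b) ring_scheme \<Rightarrow> enat"
  where "krull_dim R = Sup {enat n | n.
    \<exists>P :: nat \<Rightarrow> 'a set. (\<forall>i\<le>n. primeideal (P i) R) \<and> (\<forall>i<n. P i \<subset> P (Suc i))}"

definition depth :: "('a, 'b) ring_scheme \<Rightarrow> enat"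
  where "depth R = Sup {enat (length xs) | xs. regular_sequence R xs \<and> set xs \<subseteq> max_ideal R}"

definition cohen_macaulay_local_ring :: "('a, 'b) ring_scheme \<Rightarrow> bool"
  where "cohen_macaulay_local_ring R \<longleftrightarrow> local_ring R \<and> depth R = krull_dim R"


section \<open>Weakly reduced rings\<close>

definition weakly_reduced :: "('a, 'b) ring_scheme \<Rightarrow> bool"
  where "weakly_reduced R \<longleftrightarrow> local_ring R \<and>
    (\<forall>I. complete_intersection_ideal R I \<longrightarrow>
      saturation R I <+>\<^bsub>R\<^esub> nilradical R = saturation R (I <+>\<^bsub>R\<^esub> nilradical R))"

end

theory Submission
  imports Defs
begin

text \<open>Write \<open>J\<close> for the ideal generated by the powers \<open>\<mu>\<^sub>i ^ n\<^sub>i\<close>, \<open>N\<close> for the one generated by the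
  \<open>\<mu>\<^sub>i\<close> themselves, and \<open>R\<close> for \<open>A/J\<close>. Every \<open>\<mu>\<^sub>i\<close> is nilpotent in \<open>R\<close> and \<open>N\<close> is
  radical, so the nilradical of \<open>R\<close> is \<open>N/J\<close>, and both \<open>R\<close> and its reduction \<open>A/N\<close> are quotients of
  \<open>A\<close> by regular sequences of length \<open>d - 2\<close>. Let \<open>I\<close> be a complete intersection ideal of
  \<open>R\<close>, generated by a regular sequence with lifts \<open>y\<^sub>1, \<dots>, y\<^sub>r\<close> in \<open>A\<close>.

  If \<open>r \<ge> 2\<close>, then \<open>A\<close> has a regular sequence of length at least \<open>d\<close> inside the preimage of \<open>I\<close>. A
  nonzerodivisor modulo \<open>K\<close> that lies in a prime above \<open>K\<close> allows a strictly smaller prime above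
  \<open>K\<close>; hence a prime that contains a regular sequence of length \<open>l\<close> sits on top of a chain of
  \<open>l + 1\<close> primes (\<open>prime_chain_below\<close>). As \<open>dim A = d\<close>, the maximal ideal is the only prime over
  \<open>I\<close>, so \<open>I\<close> contains a power of it, and both saturations are all of \<open>R\<close>.

  If \<open>r = 1\<close>, write \<open>y\<close> for \<open>y\<^sub>1\<close>. Both \<open>I\<close> and \<open>I + N/J\<close> turn out to be saturated already,
  and both sides of the claim are \<open>I + N/J\<close>. First, \<open>y\<close> is regular modulo \<open>N\<close>
  and not only modulo \<open>J\<close>, because multiplication by \<open>\<mu>\<^sub>1 ^ (n\<^sub>1 - 1) \<cdots>\<close> embeds \<open>A/N\<close> into
  \<open>A/J\<close> (\<open>regular_mod_adjoin_roots\<close>). So \<open>\<mu>, y\<close> is a regular sequence of length \<open>d - 1\<close>.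
  Since \<open>A\<close> has depth \<open>d\<close> and all maximal regular sequences in an ideal have the same length
  (\<open>killed_mod_invariant\<close>), the sequence extends by some \<open>z\<close> in the maximal ideal. Replacing
  the \<open>\<mu>\<^sub>i\<close> by powers keeps \<open>\<mu>, y, z\<close> regular (\<open>weakly_regular_pow_append\<close>). Thus \<open>z\<close> is a
  nonzerodivisor modulo both \<open>(J, y)\<close> and \<open>(N, y)\<close>, and an ideal modulo which the maximal ideal contains a
  nonzerodivisor is saturated.

  The Cohen--Macaulay hypothesis enters exactly through depth \<open>d\<close> in this case and dimension
  \<open>d\<close> in the other.

  Regularity on \<open>A/K\<close> is expressed by conditions in \<open>A\<close> relative to the ideal \<open>K\<close>, which makes
  passing to a further quotient the same as enlarging \<open>K\<close>. The ring \<open>R\<close> is compared with \<open>A\<close> through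
  preimages of ideals.\<close>


section \<open>Regular sequences modulo an ideal\<close>

definition regular_mod :: "('a, 'b) ring_scheme \<Rightarrow> 'a set \<Rightarrow> 'a \<Rightarrow> bool"
  where "regular_mod R J a \<longleftrightarrow>
    a \<in> carrier R \<and> (\<forall>b\<in>carrier R. a \<otimes>\<^bsub>R\<^esub> b \<in> J \<longrightarrow> b \<in> J)"

text \<open>The recursion follows the passage from \<open>R/J\<close> to \<open>R/(J, x)\<close>; being relative to \<open>J\<close>, it permits
  induction over the sequence without forming quotient rings. Each step is a cancellation
  condition only. The condition that the last quotient be nonzero concerns the generated ideal
  and is kept apart in \<open>regular_sequence_iff\<close>.\<close>
primrec weakly_regular :: "('a, 'b) ring_scheme \<Rightarrow> 'a set \<Rightarrow> 'a list \<Rightarrow> bool"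
  where "weakly_regular R J [] \<longleftrightarrow> True"
  | "weakly_regular R J (x # xs) \<longleftrightarrow>
      regular_mod R J x \<and> weakly_regular R (Idl\<^bsub>R\<^esub> (insert x J)) xs"

lemma regular_mod_carrier: "regular_mod R J a \<Longrightarrow> a \<in> carrier R"
  by (simp add: regular_mod_def)

lemma weakly_regular_in_carrier: "weakly_regular R J xs \<Longrightarrow> set xs \<subseteq> carrier R"
  by (induction xs arbitrary: J) (auto simp: regular_mod_def)

context cring
begin

lemma Idl_Un_Idl:
  assumes "S \<subseteq> carrier R" "T \<subseteq> carrier R"
  shows "Idl (Idl S \<union> T) = Idl (S \<union> T)"
proof (rule subset_antisym)
  have "Idl S \<subseteq> Idl (S \<union> T)"
    using assms by (intro subset_Idl_subset) auto
  moreover have "T \<subseteq> Idl (S \<union> T)"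
    using genideal_self[of "S \<union> T"] assms by auto
  ultimately show "Idl (Idl S \<union> T) \<subseteq> Idl (S \<union> T)"
    using assms by (intro genideal_minimal genideal_ideal) auto
  have "Idl S \<subseteq> carrier R"
    using ideal.Icarr[OF genideal_ideal[OF assms(1)]] by auto
  then show "Idl (S \<union> T) \<subseteq> Idl (Idl S \<union> T)"
    using assms genideal_self[of S] by (intro subset_Idl_subset) auto
qed

lemma ideal_subset_carrier: "ideal I R \<Longrightarrow> I \<subseteq> carrier R"
  by (auto dest: ideal.Icarr)

lemma Idl_ideal_eq: "ideal J R \<Longrightarrow> Idl J = J"
  by (metis genideal_minimal genideal_self ideal_subset_carrier subset_antisym subset_refl)

lemma adjoin_ideal: "ideal J R \<Longrightarrow> x \<in> carrier R \<Longrightarrow> ideal (Idl (insert x J)) R"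
  by (simp add: genideal_ideal ideal_subset_carrier)

lemma Un_ideal: "ideal J R \<Longrightarrow> S \<subseteq> carrier R \<Longrightarrow> ideal (Idl (J \<union> S)) R"
  by (simp add: genideal_ideal ideal_subset_carrier)

lemma adjoin_Un:
  assumes "ideal J R" "x \<in> carrier R" "S \<subseteq> carrier R"
  shows "Idl (Idl (insert x J) \<union> S) = Idl (J \<union> insert x S)"
  using Idl_Un_Idl[of "insert x J" S] assms ideal_subset_carrier[OF assms(1)] by simp

lemma adjoin_Idl_Un:
  assumes "ideal J R" "x \<in> carrier R" "S \<subseteq> carrier R"
  shows "Idl (insert x (Idl (J \<union> S))) = Idl (J \<union> insert x S)"
  using Idl_Un_Idl[of "J \<union> S" "{x}"] assms ideal_subset_carrier[OF assms(1)] by simp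

lemma adjoin_swap:
  assumes "ideal J R" "x \<in> carrier R" "y \<in> carrier R"
  shows "Idl (insert x (Idl (insert y J))) = Idl (insert y (Idl (insert x J)))"
  using Idl_Un_Idl[of "insert y J" "{x}"] Idl_Un_Idl[of "insert x J" "{y}"] assms
    ideal_subset_carrier[OF assms(1)] by (simp add: insert_commute)

lemma adjoin_subset:
  assumes "ideal J R" "x \<in> carrier R"
  shows "J \<subseteq> Idl (insert x J)" "x \<in> Idl (insert x J)"
  using genideal_self[of "insert x J"] ideal_subset_carrier[OF assms(1)] assms(2) by auto

lemma mem_adjoin_iff:
  assumes J: "ideal J R" and x: "x \<in> carrier R"
  shows "a \<in> Idl (insert x J) \<longleftrightarrow> (\<exists>j\<in>J. \<exists>r\<in>carrier R. a = j \<oplus> r \<otimes> x)"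
proof -
  have "Idl (insert x J) = Idl (J \<union> PIdl x)"
    using Idl_Un_Idl[of "{x}" J] ideal_subset_carrier[OF J] x
    by (simp add: cgenideal_eq_genideal Un_commute)
  also have "\<dots> = J <+> PIdl x"
    by (rule union_genideal[OF J cgenideal_ideal[OF x]])
  finally show ?thesis
    by (auto simp: set_add_def' cgenideal_def)
qed

lemma ideal_diff:
  assumes "ideal J R" "a \<in> J" "b \<in> J" shows "a \<ominus> b \<in> J"
  unfolding a_minus_def using assms
  by (meson additive_subgroup.a_closed additive_subgroup.a_inv_closed ideal.axioms(1))

lemma ideal_add:
  assumes "ideal J R" "a \<in> J" "b \<in> J" shows "a \<oplus> b \<in> J"
  using assms by (meson additive_subgroup.a_closed ideal.axioms(1))

lemma regular_modD: "regular_mod R J a \<Longrightarrow> b \<in> carrier R \<Longrightarrow> a \<otimes> b \<in> J \<Longrightarrow> b \<in> J"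
  by (simp add: regular_mod_def)

text \<open>Membership in \<open>J + (x)\<close> is always used as a congruence \<open>a \<equiv> r x\<close> modulo \<open>J\<close>. In this form
  each computation with such ideals becomes a single ring identity between differences that lie
  in \<open>J\<close>.\<close>
lemma mem_adjoinI:
  assumes J: "ideal J R" "x \<in> carrier R" "r \<in> carrier R" "a \<in> carrier R" "a \<ominus> r \<otimes> x \<in> J"
  shows "a \<in> Idl (insert x J)"
proof -
  have "a = (a \<ominus> r \<otimes> x) \<oplus> r \<otimes> x"
    using assms by algebra
  then show ?thesis
    using mem_adjoin_iff[OF assms(1,2)] assms by blast
qed

lemma mem_adjoinE:
  assumes "ideal J R" "x \<in> carrier R" "a \<in> Idl (insert x J)"
  obtains r where "r \<in> carrier R" "a \<in> carrier R" "a \<ominus> r \<otimes> x \<in> J"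
proof -
  obtain j r where jr: "j \<in> J" "r \<in> carrier R" "a = j \<oplus> r \<otimes> x"
    using assms mem_adjoin_iff by blast
  have j: "j \<in> carrier R" using ideal.Icarr[OF assms(1) jr(1)] .
  have "a \<ominus> r \<otimes> x = j"
    unfolding jr(3) using j jr(2) assms(2) by algebra
  then show ?thesis
    using that[of r] jr j assms(2) by auto
qed

text \<open>This half of the exchange of two neighbours in a regular sequence holds in every commutative ring.
  From \<open>a c \<equiv> r b\<close> modulo \<open>J\<close>, regularity of \<open>b\<close> makes \<open>r \<equiv> s a\<close>, and cancelling \<open>a\<close> leaves
  \<open>c \<equiv> s b\<close>. The other half, that \<open>b\<close> is regular modulo \<open>J\<close>, would need Nakayama's lemma.\<close>
lemma regular_mod_swap:
  assumes J: "ideal J R" and a: "regular_mod R J a"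
    and b: "regular_mod R (Idl (insert a J)) b"
  shows "regular_mod R (Idl (insert b J)) a"
proof -
  have ac: "a \<in> carrier R" and bc: "b \<in> carrier R"
    using a b by (simp_all add: regular_mod_carrier)
  have "c \<in> Idl (insert b J)" if c: "c \<in> carrier R" and ac_in: "a \<otimes> c \<in> Idl (insert b J)" for c
  proof -
    obtain r where r: "r \<in> carrier R" "a \<otimes> c \<ominus> r \<otimes> b \<in> J"
      using mem_adjoinE[OF J bc ac_in] by metis
    have "b \<otimes> r \<ominus> c \<otimes> a = \<zero> \<ominus> (a \<otimes> c \<ominus> r \<otimes> b)"
      using ac bc c r(1) by algebra
    then have "b \<otimes> r \<ominus> c \<otimes> a \<in> J"
      using ideal_diff[OF J _ r(2)] additive_subgroup.zero_closed[OF ideal.axioms(1)[OF J]] by simp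
    then have "r \<in> Idl (insert a J)"
      using mem_adjoinI[OF J ac c] regular_modD[OF b r(1)] bc r(1) by simp
    then obtain s where s: "s \<in> carrier R" "r \<ominus> s \<otimes> a \<in> J"
      using mem_adjoinE[OF J ac] by metis
    have "a \<otimes> (c \<ominus> s \<otimes> b) = (a \<otimes> c \<ominus> r \<otimes> b) \<oplus> (r \<ominus> s \<otimes> a) \<otimes> b"
      using ac bc c r(1) s(1) by algebra
    then have "a \<otimes> (c \<ominus> s \<otimes> b) \<in> J"
      using ideal_add[OF J r(2) ideal.I_r_closed[OF J s(2) bc]] by simp
    then have "c \<ominus> s \<otimes> b \<in> J"
      using regular_modD[OF a] c s(1) bc by simp
    then show ?thesis
      using mem_adjoinI[OF J bc s(1) c] by simp
  qed
  then show ?thesis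
    using ac by (simp add: regular_mod_def)
qed

lemma weakly_regular_append:
  assumes "ideal J R" "set xs \<subseteq> carrier R"
  shows "weakly_regular R J (xs @ ys) \<longleftrightarrow>
    weakly_regular R J xs \<and> weakly_regular R (Idl (J \<union> set xs)) ys"
  using assms
proof (induction xs arbitrary: J)
  case Nil
  then show ?case by (simp add: Idl_ideal_eq)
next
  case (Cons x xs)
  then show ?case
    using Cons.IH[OF adjoin_ideal[of J x]] adjoin_Un[of J x "set xs"] by auto
qed

lemma weakly_regular_iff_nth:
  assumes J: "ideal J R" and "set xs \<subseteq> carrier R"
  shows "weakly_regular R J xs \<longleftrightarrow>
    (\<forall>k<length xs. regular_mod R (Idl (J \<union> set (take k xs))) (xs ! k))"
  using assms(2)
proof (induction xs rule: rev_induct)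
  case Nil
  then show ?case by simp
next
  case (snoc x xs)
  then show ?case
    using weakly_regular_append[OF J, of xs "[x]"]
    by (auto simp: nth_append less_Suc_eq all_conj_distrib)
qed

lemma nonzerodivisor_Quot_iff:
  assumes I: "ideal I R" and x: "x \<in> carrier R"
  shows "nonzerodivisor (R Quot I) (I +> x) \<longleftrightarrow> regular_mod R I x"
proof -
  interpret I: ideal I R by fact
  have zero: "I +> b = I \<longleftrightarrow> b \<in> I" if "b \<in> carrier R" for b
    using that I.a_rcos_const I.rcos_const_imp_mem by blast
  have carr: "carrier (R Quot I) = (\<lambda>b. I +> b) ` carrier R"
    by (auto simp: FactRing_def A_RCOSETS_def')
  have "nonzerodivisor (R Quot I) (I +> x) \<longleftrightarrow>
      (\<forall>b\<in>carrier R. I +> (x \<otimes> b) = I \<longrightarrow> I +> b = I)"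
    using x unfolding nonzerodivisor_def carr
    by (auto simp: FactRing_def I.rcoset_mult_add)
  also have "\<dots> \<longleftrightarrow> regular_mod R I x"
    using x by (auto simp: zero regular_mod_def)
  finally show ?thesis .
qed

lemma Idl_insert_zero:
  assumes "S \<subseteq> carrier R"
  shows "Idl (insert \<zero> S) = Idl S"
proof (rule subset_antisym)
  have I: "ideal (Idl S) R" by (rule genideal_ideal[OF assms])
  show "Idl (insert \<zero> S) \<subseteq> Idl S"
    using additive_subgroup.zero_closed[OF ideal.axioms(1)[OF I]] genideal_self[OF assms]
    by (intro genideal_minimal[OF I]) auto
  show "Idl S \<subseteq> Idl (insert \<zero> S)"
    using assms by (intro subset_Idl_subset) auto
qed

lemma regular_sequence_iff:
  "regular_sequence R xs \<longleftrightarrow>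
    set xs \<subseteq> carrier R \<and> weakly_regular R {\<zero>} xs \<and> Idl (set xs) \<noteq> carrier R"
proof (cases "set xs \<subseteq> carrier R")
  case True
  have "Idl (insert \<zero> (set (take k xs))) = Idl (set (take k xs))" for k
    by (rule Idl_insert_zero[OF order_trans[OF set_take_subset True]])
  moreover have "nonzerodivisor (R Quot (Idl (set (take k xs)))) (Idl (set (take k xs)) +> (xs ! k))
      \<longleftrightarrow> regular_mod R (Idl (set (take k xs))) (xs ! k)" if "k < length xs" for k
    using True that by (intro nonzerodivisor_Quot_iff genideal_ideal)
      (auto dest: in_set_takeD nth_mem)
  ultimately show ?thesis
    using True by (simp add: regular_sequence_def Let_def weakly_regular_iff_nth[OF zeroideal True])
qed (simp add: regular_sequence_def)

text \<open>By the exchange of neighbours, \<open>a\<close> followed by the remaining elements is weakly regular modulo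
  \<open>(J, b)\<close>, where \<open>b\<close> is the second element. So \<open>a\<close> moves past one element after the other.\<close>
lemma regular_mod_adjoin_list:
  assumes "ideal J R" "weakly_regular R J (a # bs)"
  shows "regular_mod R (Idl (J \<union> set bs)) a"
  using assms
proof (induction bs arbitrary: J)
  case Nil
  then show ?case by (simp add: Idl_ideal_eq)
next
  case (Cons b bs)
  then have a: "regular_mod R J a" and b: "regular_mod R (Idl (insert a J)) b"
    and bs: "weakly_regular R (Idl (insert b (Idl (insert a J)))) bs"
    by auto
  then have c: "a \<in> carrier R" "b \<in> carrier R" "set bs \<subseteq> carrier R"
    by (auto simp: regular_mod_def dest: weakly_regular_in_carrier)
  have "weakly_regular R (Idl (insert b J)) (a # bs)"
    using regular_mod_swap[OF Cons.prems(1) a b] bs adjoin_swap[OF Cons.prems(1) c(1,2)] by simp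
  then show ?case
    using Cons.IH[OF adjoin_ideal[OF Cons.prems(1) c(2)]] adjoin_Un[OF Cons.prems(1) c(2,3)] by simp
qed

lemma regular_mod_pow:
  assumes "regular_mod R J a"
  shows "regular_mod R J (a [^] (k::nat))"
proof (induction k)
  case (Suc k)
  have a: "a \<in> carrier R"
    by (rule regular_mod_carrier[OF assms])
  have "c \<in> J" if "c \<in> carrier R" "a [^] Suc k \<otimes> c \<in> J" for c
    using regular_modD[OF assms that(1)] regular_modD[OF Suc, of "a \<otimes> c"] that a
    by (simp add: m_assoc)
  then show ?case
    using a by (simp add: regular_mod_def)
qed (simp add: regular_mod_def)

text \<open>Induction on \<open>k\<close>: if \<open>b c\<close> lies in \<open>(J, a ^ (k + 1))\<close>, then \<open>c \<equiv> r a\<close> modulo \<open>J\<close> by regularity of \<open>b\<close>,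
  and cancelling one factor \<open>a\<close> puts \<open>b r\<close> into \<open>(J, a ^ k)\<close>.\<close>
lemma regular_mod_adjoin_pow:
  assumes J: "ideal J R" and a: "regular_mod R J a"
    and b: "regular_mod R (Idl (insert a J)) b"
  shows "regular_mod R (Idl (insert (a [^] (k::nat)) J)) b"
proof (induction k)
  case 0
  have "Idl (insert (a [^] (0::nat)) J) = carrier R"
    using ideal.one_imp_carrier[OF adjoin_ideal[OF J one_closed]] adjoin_subset[OF J one_closed]
    by simp
  then show ?case
    using b by (auto simp: regular_mod_def)
next
  case (Suc k)
  have ac: "a \<in> carrier R" and bc: "b \<in> carrier R"
    using a b by (simp_all add: regular_mod_carrier)
  have ak: "a [^] k \<in> carrier R" using ac by simp
  have "c \<in> Idl (insert (a [^] Suc k) J)"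
    if c: "c \<in> carrier R" and bc_in: "b \<otimes> c \<in> Idl (insert (a [^] Suc k) J)" for c
  proof -
    obtain s where s: "s \<in> carrier R" "b \<otimes> c \<ominus> s \<otimes> (a [^] k \<otimes> a) \<in> J"
      using mem_adjoinE[OF J _ bc_in] ac by auto
    have "b \<otimes> c \<ominus> (s \<otimes> a [^] k) \<otimes> a \<in> J"
      using s ak ac by (simp add: m_assoc)
    then have "b \<otimes> c \<in> Idl (insert a J)"
      using mem_adjoinI[OF J ac, of "s \<otimes> a [^] k"] s(1) ak bc c by blast
    then have "c \<in> Idl (insert a J)"
      using regular_modD[OF b c] by simp
    then obtain r where r: "r \<in> carrier R" "c \<ominus> r \<otimes> a \<in> J"
      using mem_adjoinE[OF J ac] by metis
    have "a \<otimes> (b \<otimes> r \<ominus> s \<otimes> a [^] k) =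
        (b \<otimes> c \<ominus> s \<otimes> (a [^] k \<otimes> a)) \<ominus> b \<otimes> (c \<ominus> r \<otimes> a)"
      using ac bc ak c r(1) s(1) by algebra
    then have "a \<otimes> (b \<otimes> r \<ominus> s \<otimes> a [^] k) \<in> J"
      using ideal_diff[OF J s(2) ideal.I_l_closed[OF J r(2) bc]] by simp
    then have "b \<otimes> r \<ominus> s \<otimes> a [^] k \<in> J"
      using regular_modD[OF a] bc r(1) s(1) ak by simp
    then have "r \<in> Idl (insert (a [^] k) J)"
      using mem_adjoinI[OF J ak s(1)] regular_modD[OF Suc r(1)] bc r(1) by simp
    then obtain t where t: "t \<in> carrier R" "r \<ominus> t \<otimes> a [^] k \<in> J"
      using mem_adjoinE[OF J ak] by metis
    have "c \<ominus> t \<otimes> (a [^] k \<otimes> a) = (c \<ominus> r \<otimes> a) \<oplus> (r \<ominus> t \<otimes> a [^] k) \<otimes> a"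
      using ac ak c r(1) t(1) by algebra
    then have "c \<ominus> t \<otimes> a [^] Suc k \<in> J"
      using ideal_add[OF J r(2) ideal.I_r_closed[OF J t(2) ac]] by simp
    then show ?thesis
      using mem_adjoinI[OF J _ t(1) c] ac by simp
  qed
  then show ?case
    using bc by (simp add: regular_mod_def)
qed

text \<open>The tail is handled one element at a time. Exchanging \<open>a\<close> with the next element \<open>b\<close> shows that
  \<open>a\<close> followed by the shorter tail is weakly regular modulo \<open>(J, b)\<close>, where the induction
  hypothesis applies.\<close>
lemma weakly_regular_pow_Cons:
  assumes "ideal J R" "weakly_regular R J (a # bs)"
  shows "weakly_regular R J (a [^] (k::nat) # bs)"
  using assms
proof (induction bs arbitrary: J)
  case Nil
  then show ?case by (simp add: regular_mod_pow)
next
  case (Cons b bs)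
  then have a: "regular_mod R J a" and b: "regular_mod R (Idl (insert a J)) b"
    and bs: "weakly_regular R (Idl (insert b (Idl (insert a J)))) bs"
    by auto
  then have c: "a \<in> carrier R" "b \<in> carrier R"
    by (auto simp: regular_mod_def)
  have "weakly_regular R (Idl (insert b J)) (a # bs)"
    using regular_mod_swap[OF Cons.prems(1) a b] bs adjoin_swap[OF Cons.prems(1) c] by simp
  then have "weakly_regular R (Idl (insert b J)) (a [^] k # bs)"
    using Cons.IH[OF adjoin_ideal[OF Cons.prems(1) c(2)]] by simp
  then show ?case
    using regular_mod_pow[OF a] regular_mod_adjoin_pow[OF Cons.prems(1) a b]
      adjoin_swap[OF Cons.prems(1) _ c(2), of "a [^] k"] c(1) by simp
qed

lemma weakly_regular_pow_append:
  assumes "ideal J R" "weakly_regular R J (xs @ ys)" "length ns = length xs"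
  shows "weakly_regular R J (map2 (\<lambda>x k. x [^] (k::nat)) xs ns @ ys)"
  using assms
proof (induction xs arbitrary: J ns)
  case Nil
  then show ?case by simp
next
  case (Cons x xs)
  obtain k ns' where ns: "ns = k # ns'"
    using Cons.prems(3) by (cases ns) simp_all
  have x: "x \<in> carrier R"
    using Cons.prems(2) by (auto dest: regular_mod_carrier)
  have "weakly_regular R J (x [^] k # (xs @ ys))"
    using weakly_regular_pow_Cons[OF Cons.prems(1), of x "xs @ ys"] Cons.prems(2) by simp
  then have x_pow: "regular_mod R J (x [^] k)"
    and "weakly_regular R (Idl (insert (x [^] k) J)) (xs @ ys)"
    by simp_all
  then have "weakly_regular R (Idl (insert (x [^] k) J)) (map2 (\<lambda>x k. x [^] (k::nat)) xs ns' @ ys)"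
    using Cons.prems(3) ns x by (intro Cons.IH adjoin_ideal[OF Cons.prems(1)]) simp_all
  then show ?case
    using x_pow ns by simp
qed

text \<open>Multiplication by \<open>a ^ (k - 1)\<close> embeds \<open>R/(J, a)\<close> into \<open>R/(J, a ^ k)\<close>, and a nonzerodivisor on a
  module is one on every submodule.\<close>
lemma regular_mod_adjoin_root:
  assumes J: "ideal J R" and a: "regular_mod R J a" and k: "k \<noteq> (0::nat)"
    and x: "regular_mod R (Idl (insert (a [^] k) J)) x"
  shows "regular_mod R (Idl (insert a J)) x"
proof -
  obtain l where k': "k = Suc l"
    using k by (cases k) auto
  have ac: "a \<in> carrier R" and xc: "x \<in> carrier R"
    using a x by (simp_all add: regular_mod_carrier)
  have al: "a [^] l \<in> carrier R" using ac by simp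
  have "c \<in> Idl (insert a J)" if c: "c \<in> carrier R" and xc_in: "x \<otimes> c \<in> Idl (insert a J)" for c
  proof -
    obtain r where r: "r \<in> carrier R" "x \<otimes> c \<ominus> r \<otimes> a \<in> J"
      using mem_adjoinE[OF J ac xc_in] by metis
    have "x \<otimes> (a [^] l \<otimes> c) \<ominus> r \<otimes> (a [^] l \<otimes> a) = a [^] l \<otimes> (x \<otimes> c \<ominus> r \<otimes> a)"
      using ac al xc c r(1) by algebra
    then have "x \<otimes> (a [^] l \<otimes> c) \<ominus> r \<otimes> a [^] k \<in> J"
      using ideal.I_l_closed[OF J r(2) al] by (simp add: k')
    then have "a [^] l \<otimes> c \<in> Idl (insert (a [^] k) J)"
      using mem_adjoinI[OF J _ r(1)] regular_modD[OF x] ac al c xc by simp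
    then obtain s where s: "s \<in> carrier R" "a [^] l \<otimes> c \<ominus> s \<otimes> (a [^] l \<otimes> a) \<in> J"
      using mem_adjoinE[OF J] ac k' by (metis nat_pow_Suc nat_pow_closed)
    have "a [^] l \<otimes> (c \<ominus> s \<otimes> a) = a [^] l \<otimes> c \<ominus> s \<otimes> (a [^] l \<otimes> a)"
      using ac al c s(1) by algebra
    then have "c \<ominus> s \<otimes> a \<in> J"
      using regular_modD[OF regular_mod_pow[OF a, of l]] s ac c by simp
    then show ?thesis
      using mem_adjoinI[OF J ac s(1) c] by simp
  qed
  then show ?thesis
    using xc by (simp add: regular_mod_def)
qed

text \<open>The powers are removed from the front. After the induction hypothesis has removed those of the
  tail \<open>xs\<close>, the head is still regular modulo \<open>(J, xs)\<close> by exchange, so its power can be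
  removed as well.\<close>
lemma regular_mod_adjoin_roots:
  assumes "ideal J R" "weakly_regular R J xs" "length ns = length xs" "0 \<notin> set ns"
    "regular_mod R (Idl (J \<union> set (map2 (\<lambda>x k. x [^] (k::nat)) xs ns))) y"
  shows "regular_mod R (Idl (J \<union> set xs)) y"
  using assms
proof (induction xs arbitrary: J ns)
  case Nil
  then show ?case by simp
next
  case (Cons x xs)
  obtain k ns' where ns: "ns = k # ns'"
    using Cons.prems(3) by (cases ns) simp_all
  have c: "x \<in> carrier R" "set xs \<subseteq> carrier R"
    using weakly_regular_in_carrier[OF Cons.prems(2)] by auto
  then have c': "x [^] k \<in> carrier R"
      "set (map2 (\<lambda>x k. x [^] (k::nat)) xs ns') \<subseteq> carrier R"
    by (auto dest!: set_zip_leftD)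
  have J': "ideal (Idl (insert (x [^] k) J)) R"
    by (rule adjoin_ideal[OF Cons.prems(1) c'(1)])
  have "weakly_regular R (Idl (insert (x [^] k) J)) xs"
    using weakly_regular_pow_Cons[OF Cons.prems(1,2)] by simp
  then have "regular_mod R (Idl (Idl (insert (x [^] k) J) \<union> set xs)) y"
    using Cons.prems(3-5) ns adjoin_Un[OF Cons.prems(1) c']
    by (intro Cons.IH[OF J', of ns']) simp_all
  then have y: "regular_mod R (Idl (insert (x [^] k) (Idl (J \<union> set xs)))) y"
    using adjoin_Un[OF Cons.prems(1) c'(1) c(2)] adjoin_Idl_Un[OF Cons.prems(1) c'(1) c(2)] by simp
  have "k \<noteq> 0"
    using Cons.prems(4) ns by auto
  then have "regular_mod R (Idl (insert x (Idl (J \<union> set xs)))) y"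
    using y by (rule regular_mod_adjoin_root[OF Un_ideal[OF Cons.prems(1) c(2)]
          regular_mod_adjoin_list[OF Cons.prems(1,2)]])
  then show ?case
    using adjoin_Idl_Un[OF Cons.prems(1) c] by simp
qed

end


section \<open>Primes in Noetherian rings\<close>

lemma (in noetherian_ring) maximal_ideal_in_family:
  assumes "F \<subseteq> {I. ideal I R}" "F \<noteq> {}"
  obtains M where "M \<in> F" "\<And>I. I \<in> F \<Longrightarrow> M \<subseteq> I \<Longrightarrow> I = M"
proof -
  have "\<exists>M\<in>F. \<forall>I\<in>F. M \<subseteq> I \<longrightarrow> I = M"
  proof (rule subset_Zorn)
    fix C assume C: "subset.chain F C"
    show "\<exists>U\<in>F. \<forall>I\<in>C. I \<subseteq> U"
    proof (cases "C = {}")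
      case True
      then show ?thesis using assms(2) by auto
    next
      case False
      have "subset.chain {I. ideal I R} C"
        using C assms(1) unfolding pred_on.chain_def by auto
      then have "\<Union>C \<in> C"
        by (rule ideal_chain_is_trivial[OF False])
      then have "\<Union>C \<in> F"
        using C unfolding pred_on.chain_def by auto
      then show ?thesis
        by (intro bexI[of _ "\<Union>C"]) auto
    qed
  qed
  then show ?thesis
    using that by blast
qed

context cring
begin

lemma mem_ideal_pow:
  assumes "ideal I R" "x \<in> I" "k \<noteq> (0::nat)"
  shows "x [^] k \<in> I"
proof -
  obtain l where "k = Suc l" using assms(3) not0_implies_Suc by blast
  then show ?thesis
    using ideal.I_l_closed[OF assms(1,2), of "x [^] l"] ideal.Icarr[OF assms(1,2)] by simp
qed

lemma prime_contains_root:
  assumes P: "primeideal P R" and x: "x \<in> carrier R" "x [^] (k::nat) \<in> P"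
  shows "x \<in> P"
  using x(2)
proof (induction k)
  case 0
  then show ?case
    using primeideal.I_notcarr[OF P] ideal.one_imp_carrier[OF primeideal.axioms(1)[OF P]] by simp
next
  case (Suc k)
  then show ?case
    using primeideal.I_prime[OF P, of "x [^] k" x] x(1) by auto
qed

lemma pow_mem_ideal_power:
  assumes "ideal M R" "y \<in> M"
  shows "y [^] (i::nat) \<in> M [^]\<^bsub>ideals_set R\<^esub> i"
proof (induction i)
  case 0
  then show ?case by (simp add: ideals_set_def nat_pow_def)
next
  case (Suc i)
  then show ?case
    using ideal_prod.prod[OF Suc assms(2), of R] by (simp add: ideals_set_def nat_pow_def)
qed

lemma ideal_power_one:
  assumes "ideal M R"
  shows "M [^]\<^bsub>ideals_set R\<^esub> (1::nat) = M"
proof -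
  interpret S: comm_monoid "ideals_set R" by (rule ideals_set_is_comm_monoid)
  show ?thesis
    using assms by (intro S.nat_pow_eone) (simp add: ideals_set_def)
qed

text \<open>This shows that an ideal maximal among those that miss a multiplicative set, or among those that contain no
  power of a given ideal, is prime: if neither \<open>a\<close> nor \<open>b\<close> lies in \<open>K\<close>, both enlarged ideals
  violate the property, and so does \<open>K\<close>, which contains their product.\<close>
lemma mult_mem_adjoin:
  assumes K: "ideal K R" and a: "a \<in> carrier R" and b: "b \<in> carrier R" and ab: "a \<otimes> b \<in> K"
    and s: "s \<in> Idl (insert a K)" and t: "t \<in> Idl (insert b K)"
  shows "s \<otimes> t \<in> K"
proof -
  obtain r where r: "r \<in> carrier R" "s \<in> carrier R" "s \<ominus> r \<otimes> a \<in> K"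
    by (rule mem_adjoinE[OF K a s])
  obtain q where q: "q \<in> carrier R" "t \<in> carrier R" "t \<ominus> q \<otimes> b \<in> K"
    by (rule mem_adjoinE[OF K b t])
  have "s \<otimes> t = ((s \<ominus> r \<otimes> a) \<otimes> t \<oplus> (r \<otimes> a) \<otimes> (t \<ominus> q \<otimes> b)) \<oplus> (r \<otimes> q) \<otimes> (a \<otimes> b)"
    using a b r(1,2) q(1,2) by algebra
  also have "\<dots> \<in> K"
    using ideal_add[OF K ideal_add[OF K ideal.I_r_closed[OF K r(3) q(2)]
          ideal.I_l_closed[OF K q(3) m_closed[OF r(1) a]]]
        ideal.I_l_closed[OF K ab m_closed[OF r(1) q(1)]]] .
  finally show ?thesis .
qed

end

locale noetherian_cring = cring R + noetherian_ring R for R (structure)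
begin

text \<open>An ideal maximal among those that contain \<open>J\<close> and miss \<open>S\<close> is prime: if neither factor of a product in
  \<open>P\<close> lay in \<open>P\<close>, then \<open>S\<close> would meet both enlarged ideals, hence, being closed under products, \<open>P\<close>.\<close>
lemma prime_disjoint_from_multiplicative_set:
  assumes J: "ideal J R" and S: "\<one> \<in> S" "S \<subseteq> carrier R"
    "\<And>s t. s \<in> S \<Longrightarrow> t \<in> S \<Longrightarrow> s \<otimes> t \<in> S" "J \<inter> S = {}"
  obtains P where "primeideal P R" "J \<subseteq> P" "P \<inter> S = {}"
proof -
  define F where "F = {I. ideal I R \<and> J \<subseteq> I \<and> I \<inter> S = {}}"
  have "F \<subseteq> {I. ideal I R}" "F \<noteq> {}"
    using J S(4) by (auto simp: F_def)
  then obtain P where P: "P \<in> F" "\<And>I. I \<in> F \<Longrightarrow> P \<subseteq> I \<Longrightarrow> I = P"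
    by (rule maximal_ideal_in_family) blast
  then have PI: "ideal P R" "J \<subseteq> P" "P \<inter> S = {}"
    by (auto simp: F_def)
  have meets: "\<exists>s\<in>S. s \<in> Idl (insert a P)" if a: "a \<in> carrier R" "a \<notin> P" for a
  proof -
    have "Idl (insert a P) \<notin> F"
      using P(2)[of "Idl (insert a P)"] adjoin_subset[OF PI(1) a(1)] a(2) by blast
    then show ?thesis
      using adjoin_ideal[OF PI(1) a(1)] adjoin_subset[OF PI(1) a(1)] PI(2)
      unfolding F_def by blast
  qed
  have "primeideal P R"
  proof (rule primeidealI[OF PI(1) is_cring])
    show "carrier R \<noteq> P"
      using PI(3) S(1) by auto
    fix a b assume a: "a \<in> carrier R" and b: "b \<in> carrier R" and ab: "a \<otimes> b \<in> P"
    show "a \<in> P \<or> b \<in> P"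
    proof (rule ccontr)
      assume "\<not> (a \<in> P \<or> b \<in> P)"
      then obtain s s' where s: "s \<in> S" "s \<in> Idl (insert a P)" "s' \<in> S" "s' \<in> Idl (insert b P)"
        using meets[OF a] meets[OF b] by blast
      then have "s \<otimes> s' \<in> P"
        using mult_mem_adjoin[OF PI(1) a b ab] by blast
      then show False
        using S(3)[OF s(1,3)] PI(3) by auto
    qed
  qed
  then show ?thesis
    using that PI by blast
qed

lemma prime_avoiding_powers:
  assumes J: "ideal J R" and z: "z \<in> carrier R" "\<And>n::nat. z [^] n \<notin> J"
  obtains P where "primeideal P R" "J \<subseteq> P" "z \<notin> P"
proof -
  have "z \<in> range (\<lambda>n::nat. z [^] n)"
    using z(1) nat_pow_eone by (metis rangeI)
  moreover obtain P where "primeideal P R" "J \<subseteq> P" "P \<inter> range (\<lambda>n::nat. z [^] n) = {}"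
  proof (rule prime_disjoint_from_multiplicative_set[OF J])
    show "\<one> \<in> range (\<lambda>n::nat. z [^] n)"
      by (metis nat_pow_0 rangeI)
    show "s \<otimes> t \<in> range (\<lambda>n::nat. z [^] n)"
      if "s \<in> range (\<lambda>n::nat. z [^] n)" "t \<in> range (\<lambda>n::nat. z [^] n)" for s t
      using that z(1) by (auto simp: nat_pow_mult)
  qed (use z in auto)
  ultimately show ?thesis
    using that by blast
qed

text \<open>A prime that contains the powers contains the \<open>x\<^sub>i\<close>. Hence no prime can contain the ideal of the
  powers and miss all powers of \<open>a\<close>; arguing with primes avoids multinomial expansions.\<close>
lemma nil_mod_powers:
  assumes "set xs \<subseteq> carrier R" "length ns = length xs"
    and a: "a \<in> Idl (set xs)"
  shows "\<exists>k::nat. a [^] k \<in> Idl (set (map2 (\<lambda>x k. x [^] (k::nat)) xs ns))"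
proof (rule ccontr)
  let ?J = "Idl (set (map2 (\<lambda>x k. x [^] (k::nat)) xs ns))"
  assume "\<not> ?thesis"
  then have no: "\<And>k::nat. a [^] k \<notin> ?J" by blast
  have ac: "a \<in> carrier R"
    using ideal.Icarr[OF genideal_ideal[OF assms(1)] a] .
  have powers: "set (map2 (\<lambda>x k. x [^] (k::nat)) xs ns) \<subseteq> carrier R"
    using assms(1) by (auto dest!: set_zip_leftD)
  obtain P where P: "primeideal P R" "?J \<subseteq> P" "a \<notin> P"
    by (rule prime_avoiding_powers[OF genideal_ideal[OF powers] ac no])
  have "x \<in> P" if x: "x \<in> set xs" for x
  proof -
    obtain i where i: "i < length xs" "x = xs ! i"
      using x by (auto simp: in_set_conv_nth)
    then have "(x, ns ! i) \<in> set (zip xs ns)"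
      using assms(2) by (auto simp: set_zip)
    then have "x [^] (ns ! i) \<in> set (map2 (\<lambda>x k. x [^] (k::nat)) xs ns)"
      by force
    then have "x [^] (ns ! i) \<in> P"
      using P(2) genideal_self[OF powers] by blast
    then show ?thesis
      using prime_contains_root[OF P(1)] x assms(1) by blast
  qed
  then have "Idl (set xs) \<subseteq> P"
    by (intro genideal_minimal primeideal.axioms(1)[OF P(1)]) blast
  then show False
    using a P(3) by blast
qed

text \<open>Apply \<open>prime_disjoint_from_multiplicative_set\<close> to the multiplicative set of all \<open>s y ^ n\<close> with \<open>s\<close> outside
  \<open>Q\<close>. It misses \<open>J\<close> because \<open>y\<close> can be cancelled modulo \<open>J\<close> and \<open>J\<close> lies in \<open>Q\<close>. A prime that
  misses it lies in \<open>Q\<close> and does not contain \<open>y\<close>.\<close>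
lemma smaller_prime_without_regular_element:
  assumes Q: "primeideal Q R" and J: "ideal J R" "J \<subseteq> Q" and y: "regular_mod R J y" "y \<in> Q"
  obtains P where "primeideal P R" "J \<subseteq> P" "P \<subset> Q"
proof -
  have yc: "y \<in> carrier R" by (rule regular_mod_carrier[OF y(1)])
  have Qc: "Q \<noteq> carrier R" "ideal Q R"
    using Q primeideal.I_notcarr primeideal.axioms(1) by blast+
  define S where "S = {s \<otimes> y [^] (n::nat) |s n. s \<in> carrier R - Q}"
  have one: "\<one> \<in> carrier R - Q"
    using Qc ideal.one_imp_carrier by auto
  have S1: "s \<in> S" if "s \<in> carrier R - Q" for s
    using that unfolding S_def by (intro CollectI exI[of _ s] exI[of _ 0]) auto
  have "\<one> \<otimes> y [^] (1::nat) \<in> S"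
    using one unfolding S_def by blast
  then have yS: "y \<in> S" using yc by simp
  obtain P where P: "primeideal P R" "J \<subseteq> P" "P \<inter> S = {}"
  proof (rule prime_disjoint_from_multiplicative_set[OF J(1)])
    show "\<one> \<in> S" by (rule S1[OF one])
    show "S \<subseteq> carrier R" using yc by (auto simp: S_def)
    show "a \<otimes> b \<in> S" if "a \<in> S" "b \<in> S" for a b
    proof -
      obtain s t and n m :: nat where st: "a = s \<otimes> y [^] n" "b = t \<otimes> y [^] m"
        "s \<in> carrier R - Q" "t \<in> carrier R - Q"
        using \<open>a \<in> S\<close> \<open>b \<in> S\<close> unfolding S_def by blast
      have "a \<otimes> b = (s \<otimes> t) \<otimes> (y [^] n \<otimes> y [^] m)"
        using st yc nat_pow_closed[OF yc, of n] nat_pow_closed[OF yc, of m] by (simp add: m_ac)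
      moreover have "s \<otimes> t \<in> carrier R - Q"
        using primeideal.I_prime[OF Q] st by auto
      ultimately show ?thesis
        using yc unfolding S_def by (auto simp: nat_pow_mult)
    qed
    show "J \<inter> S = {}"
    proof (rule ccontr)
      assume "J \<inter> S \<noteq> {}"
      then obtain s n where s: "s \<in> carrier R - Q" "s \<otimes> y [^] (n::nat) \<in> J"
        unfolding S_def by blast
      then have "s \<in> J"
        using regular_modD[OF regular_mod_pow[OF y(1)], of s n] m_comm yc by simp
      then show False using s J(2) by blast
    qed
  qed
  have "P \<subseteq> Q"
    using S1 P(3) ideal.Icarr[OF primeideal.axioms(1)[OF P(1)]] by blast
  moreover have "y \<notin> P"
    using yS P(3) by blast
  ultimately show ?thesis
    using that P y(2) by blast
qed

text \<open>The last element of the sequence produces a strictly smaller prime over the ideal of the earlier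
  ones, and the induction continues from there.\<close>
lemma prime_chain_below:
  assumes J: "ideal J R" and "weakly_regular R J xs" "primeideal Q R" "J \<union> set xs \<subseteq> Q"
  shows "\<exists>P :: nat \<Rightarrow> 'a set. (\<forall>i\<le>length xs. primeideal (P i) R) \<and>
    (\<forall>i<length xs. P i \<subset> P (Suc i)) \<and> P (length xs) = Q"
  using assms(2-4)
proof (induction xs arbitrary: Q rule: rev_induct)
  case Nil
  then show ?case by auto
next
  case (snoc x xs)
  have c: "set xs \<subseteq> carrier R"
    using weakly_regular_in_carrier[OF snoc.prems(1)] by auto
  have xs: "weakly_regular R J xs" and x: "regular_mod R (Idl (J \<union> set xs)) x"
    using snoc.prems(1) weakly_regular_append[OF J c, of "[x]"] by auto
  have "Idl (J \<union> set xs) \<subseteq> Q"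
    using snoc.prems by (intro genideal_minimal) (auto simp: primeideal.axioms(1))
  moreover have "x \<in> Q" using snoc.prems(3) by simp
  ultimately obtain Q' where Q': "primeideal Q' R" "Idl (J \<union> set xs) \<subseteq> Q'" "Q' \<subset> Q"
    using smaller_prime_without_regular_element[OF snoc.prems(2) Un_ideal[OF J c] _ x] by blast
  have "J \<union> set xs \<subseteq> Q'"
    using genideal_self[of "J \<union> set xs"] ideal_subset_carrier[OF J] c Q'(2) by auto
  then obtain P where P: "\<forall>i\<le>length xs. primeideal (P i) R"
    "\<forall>i<length xs. P i \<subset> P (Suc i)" "P (length xs) = Q'"
    using snoc.IH[OF xs Q'(1)] by blast
  define P' where "P' = P(Suc (length xs) := Q)"
  have "(\<forall>i\<le>length (xs @ [x]). primeideal (P' i) R) \<and>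
    (\<forall>i<length (xs @ [x]). P' i \<subset> P' (Suc i)) \<and> P' (length (xs @ [x])) = Q"
    using P Q' snoc.prems(2) by (auto simp: P'_def le_Suc_eq less_Suc_eq)
  then show ?case by blast
qed

text \<open>An ideal maximal among those over \<open>I\<close> that contain no power of \<open>M\<close> would be prime, hence equal
  to \<open>M\<close>, which contains its own first power.\<close>
lemma ideal_power_subset:
  assumes M: "primeideal M R" and I: "ideal I R"
    and only: "\<And>P. primeideal P R \<Longrightarrow> I \<subseteq> P \<Longrightarrow> P = M"
  shows "\<exists>k\<ge>1. M [^]\<^bsub>ideals_set R\<^esub> (k::nat) \<subseteq> I"
proof (rule ccontr)
  assume no: "\<not> ?thesis"
  interpret S: comm_monoid "ideals_set R" by (rule ideals_set_is_comm_monoid)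
  have MI: "ideal M R" using M primeideal.axioms(1) by blast
  have Mk: "ideal (M [^]\<^bsub>ideals_set R\<^esub> (k::nat)) R" for k
    using S.nat_pow_closed[of M k] MI by (simp add: ideals_set_def)
  define F where "F = {K. ideal K R \<and> I \<subseteq> K \<and> (\<forall>k\<ge>1. \<not> M [^]\<^bsub>ideals_set R\<^esub> (k::nat) \<subseteq> K)}"
  have "F \<subseteq> {I. ideal I R}" "F \<noteq> {}"
    using I no by (auto simp: F_def)
  then obtain K where K: "K \<in> F" "\<And>L. L \<in> F \<Longrightarrow> K \<subseteq> L \<Longrightarrow> L = K"
    by (rule maximal_ideal_in_family) blast
  then have KI: "ideal K R" "I \<subseteq> K"
    and Kk: "\<And>k::nat. k \<ge> 1 \<Longrightarrow> \<not> M [^]\<^bsub>ideals_set R\<^esub> k \<subseteq> K"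
    by (auto simp: F_def)
  have grow: "\<exists>k\<ge>1. M [^]\<^bsub>ideals_set R\<^esub> (k::nat) \<subseteq> Idl (insert a K)"
    if a: "a \<in> carrier R" "a \<notin> K" for a
  proof -
    have "Idl (insert a K) \<notin> F"
      using K(2)[of "Idl (insert a K)"] adjoin_subset[OF KI(1) a(1)] a(2) by blast
    then show ?thesis
      using adjoin_ideal[OF KI(1) a(1)] adjoin_subset[OF KI(1) a(1)] KI(2)
      unfolding F_def by blast
  qed
  have M1: "M [^]\<^bsub>ideals_set R\<^esub> (1::nat) = M"
    by (rule ideal_power_one[OF MI])
  have "primeideal K R"
  proof (rule primeidealI[OF KI(1) is_cring])
    show "carrier R \<noteq> K"
      using Kk[of 1] M1 ideal_subset_carrier[OF MI] by auto
    fix a b assume a: "a \<in> carrier R" and b: "b \<in> carrier R" and ab: "a \<otimes> b \<in> K"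
    show "a \<in> K \<or> b \<in> K"
    proof (rule ccontr)
      assume "\<not> (a \<in> K \<or> b \<in> K)"
      then obtain i j :: nat where ij: "i \<ge> 1" "M [^]\<^bsub>ideals_set R\<^esub> i \<subseteq> Idl (insert a K)"
        "j \<ge> 1" "M [^]\<^bsub>ideals_set R\<^esub> j \<subseteq> Idl (insert b K)"
        using grow[OF a] grow[OF b] by blast
      have "x \<in> K" if "x \<in> (M [^]\<^bsub>ideals_set R\<^esub> i) \<cdot> (M [^]\<^bsub>ideals_set R\<^esub> j)" for x
        using that
      proof (induction rule: ideal_prod.induct)
        case (prod s t)
        then show ?case
          using mult_mem_adjoin[OF KI(1) a b ab] ij by blast
      next
        case (sum s t)
        then show ?case using ideal_add[OF KI(1)] by blast
      qed
      moreover have "(M [^]\<^bsub>ideals_set R\<^esub> i) \<cdot> (M [^]\<^bsub>ideals_set R\<^esub> j) = M [^]\<^bsub>ideals_set R\<^esub> (i + j)"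
        using S.nat_pow_mult[of M i j] MI by (simp add: ideals_set_def)
      ultimately show False
        using Kk[of "i + j"] ij(1) by auto
    qed
  qed
  then have "K = M"
    using only KI(2) by blast
  then show False
    using Kk[of 1] M1 by simp
qed

end


section \<open>Maximal regular sequences have the same length\<close>

text \<open>Some nonzero element of \<open>R/J\<close> is annihilated by \<open>M\<close>; over a Noetherian ring this says that
  \<open>M\<close> consists of zero divisors on \<open>R/J\<close>. For a maximal ideal \<open>M\<close> it says that \<open>R/J\<close> has a nonzero socle.\<close>
definition killed_mod :: "('a, 'b) ring_scheme \<Rightarrow> 'a set \<Rightarrow> 'a set \<Rightarrow> bool"
  where "killed_mod R M J \<longleftrightarrow> (\<exists>u\<in>carrier R - J. \<forall>t\<in>M. t \<otimes>\<^bsub>R\<^esub> u \<in> J)"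

context cring
begin

lemma ideal_colon_ideal:
  assumes J: "ideal J R" and "S \<subseteq> carrier R"
  shows "ideal (ideal_colon R J S) R"
proof (rule idealI[OF ring_axioms])
  have c: "s \<in> carrier R" if "s \<in> S" for s using assms(2) that by auto
  show "subgroup (ideal_colon R J S) (add_monoid R)"
  proof (rule add.subgroupI)
    show "ideal_colon R J S \<subseteq> carrier R"
      by (auto simp: ideal_colon_def)
    have "\<zero> \<in> ideal_colon R J S"
      using c additive_subgroup.zero_closed[OF ideal.axioms(1)[OF J]] by (simp add: ideal_colon_def)
    then show "ideal_colon R J S \<noteq> {}" by blast
    show "\<ominus> a \<in> ideal_colon R J S" if "a \<in> ideal_colon R J S" for a
      using that c additive_subgroup.a_inv_closed[OF ideal.axioms(1)[OF J]]
      by (simp add: ideal_colon_def l_minus)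
    show "a \<oplus> b \<in> ideal_colon R J S" if "a \<in> ideal_colon R J S" "b \<in> ideal_colon R J S" for a b
      using that c ideal_add[OF J] by (simp add: ideal_colon_def l_distr)
  qed
  show "x \<otimes> a \<in> ideal_colon R J S" if "a \<in> ideal_colon R J S" "x \<in> carrier R" for a x
    using that c ideal.I_l_closed[OF J] by (simp add: ideal_colon_def m_assoc)
  then show "a \<otimes> x \<in> ideal_colon R J S" if "a \<in> ideal_colon R J S" "x \<in> carrier R" for a x
    using that m_comm[of a x] by (auto simp: ideal_colon_def)
qed

lemma colon_singleton: "ideal_colon R J {u} = {t \<in> carrier R. t \<otimes> u \<in> J}"
  by (auto simp: ideal_colon_def)

lemma prime_not_containing_Int:
  assumes P: "primeideal P R" and I: "ideal I R" "\<not> I \<subseteq> P"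
    and "finite F" "\<And>Q. Q \<in> F \<Longrightarrow> ideal Q R \<and> \<not> Q \<subseteq> P"
  shows "\<exists>w\<in>I. w \<notin> P \<and> (\<forall>Q\<in>F. w \<in> Q)"
  using assms(4,5)
proof (induction F)
  case empty
  then show ?case using I by auto
next
  case (insert Q F)
  then obtain w where w: "w \<in> I" "w \<notin> P" "\<forall>Q\<in>F. w \<in> Q" by auto
  obtain q where q: "q \<in> Q" "q \<notin> P" using insert.prems[of Q] by auto
  have Q: "ideal Q R" using insert.prems by simp
  have c: "w \<in> carrier R" "q \<in> carrier R"
    using ideal.Icarr[OF I(1) w(1)] ideal.Icarr[OF Q q(1)] by auto
  have "w \<otimes> q \<notin> P"
    using primeideal.I_prime[OF P c] w q by auto
  moreover have "w \<otimes> q \<in> I" "w \<otimes> q \<in> Q"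
    using ideal.I_r_closed[OF I(1) w(1) c(2)] ideal.I_l_closed[OF Q q(1) c(1)] by auto
  moreover have "w \<otimes> q \<in> Q'" if "Q' \<in> F" for Q'
    using ideal.I_r_closed[of Q' R w q] insert.prems that w c by auto
  ultimately show ?case by blast
qed

text \<open>In a family without inclusions take \<open>z\<close> that avoids all members except \<open>P\<close>. If \<open>z\<close> fails to avoid
  \<open>P\<close>, it is corrected by an element outside \<open>P\<close> that lies in all other members.\<close>
lemma prime_avoidance:
  assumes I: "ideal I R" and "finite F" "\<And>P. P \<in> F \<Longrightarrow> primeideal P R \<and> \<not> I \<subseteq> P"
  shows "\<exists>z\<in>I. \<forall>P\<in>F. z \<notin> P"
  using assms(2,3)
proof (induction F rule: finite_psubset_induct)
  case (psubset F)
  show ?case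
  proof (cases "F = {}")
    case True
    then show ?thesis
      using additive_subgroup.zero_closed[OF ideal.axioms(1)[OF I]] by auto
  next
    case nonempty: False
    show ?thesis
    proof (cases "\<exists>P\<in>F. \<exists>Q\<in>F. Q \<noteq> P \<and> Q \<subseteq> P")
      case True
      then obtain P Q where PQ: "P \<in> F" "Q \<in> F" "Q \<noteq> P" "Q \<subseteq> P" by blast
      obtain z where "z \<in> I" "\<forall>P'\<in>F - {Q}. z \<notin> P'"
        using psubset.IH[of "F - {Q}"] psubset.prems PQ(2) by blast
      then show ?thesis using PQ by blast
    next
      case False
      obtain P where P: "P \<in> F" using nonempty by blast
      then have prime: "primeideal P R" and "\<not> I \<subseteq> P" using psubset.prems by auto
      obtain z where z: "z \<in> I" "\<forall>Q\<in>F - {P}. z \<notin> Q"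
        using psubset.IH[of "F - {P}"] psubset.prems P by blast
      show ?thesis
      proof (cases "z \<in> P")
        case zP: True
        have ideals: "ideal Q R" if "Q \<in> F" for Q
          using that psubset.prems by (simp add: primeideal.axioms(1))
        have "\<exists>w\<in>I. w \<notin> P \<and> (\<forall>Q\<in>F - {P}. w \<in> Q)"
          using prime_not_containing_Int[OF prime I \<open>\<not> I \<subseteq> P\<close>, of "F - {P}"] False P ideals
            psubset.hyps by blast
        then obtain w where w: "w \<in> I" "w \<notin> P" "\<forall>Q\<in>F - {P}. w \<in> Q" by blast
        have c: "z \<in> carrier R" "w \<in> carrier R"
          using ideal.Icarr[OF I] z(1) w(1) by auto
        have "z \<oplus> w \<notin> Q" if Q: "Q \<in> F" for Q
        proof
          assume zw: "z \<oplus> w \<in> Q"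
          have diff: "(z \<oplus> w) \<ominus> z = w" "(z \<oplus> w) \<ominus> w = z"
            using c by algebra+
          show False
            using ideal_diff[OF ideals[OF Q] zw, of z] ideal_diff[OF ideals[OF Q] zw, of w]
              diff z w zP Q by (cases "Q = P") auto
        qed
        then show ?thesis
          using ideal_add[OF I z(1) w(1)] by blast
      next
        case False
        then show ?thesis using z by blast
      qed
    qed
  qed
qed

lemma regular_mod_imp_not_killed:
  assumes "regular_mod R K z" "z \<in> M"
  shows "\<not> killed_mod R M K"
proof
  assume "killed_mod R M K"
  then obtain u where "u \<in> carrier R - K" "z \<otimes> u \<in> K"
    unfolding killed_mod_def using assms(2) by blast
  then show False
    using regular_modD[OF assms(1)] by blast
qed

text \<open>If \<open>u\<close> represents an element of \<open>R/(J, x)\<close> killed by \<open>M\<close>, then \<open>y u \<equiv> a x\<close> modulo \<open>J\<close>, and \<open>a\<close>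
  represents one of \<open>R/(J, y)\<close>. The relation is symmetric in \<open>(u, x)\<close> and \<open>(a, y)\<close>,
  so \<open>a\<close> vanishes only if \<open>u\<close> does.\<close>
lemma killed_mod_exchange:
  assumes J: "ideal J R" and M: "ideal M R"
    and x: "x \<in> M" "regular_mod R J x" and y: "y \<in> M" "regular_mod R J y"
    and killed: "killed_mod R M (Idl (insert x J))"
  shows "killed_mod R M (Idl (insert y J))"
proof -
  have c: "x \<in> carrier R" "y \<in> carrier R"
    using x y by (simp_all add: regular_mod_carrier)
  obtain u where u: "u \<in> carrier R" "u \<notin> Idl (insert x J)"
    "\<And>t. t \<in> M \<Longrightarrow> t \<otimes> u \<in> Idl (insert x J)"
    using killed unfolding killed_mod_def by blast
  obtain a where a: "a \<in> carrier R" "y \<otimes> u \<ominus> a \<otimes> x \<in> J"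
    using mem_adjoinE[OF J c(1) u(3)[OF y(1)]] by metis
  have "a \<notin> Idl (insert y J)"
  proof
    assume "a \<in> Idl (insert y J)"
    then obtain b where b: "b \<in> carrier R" "a \<ominus> b \<otimes> y \<in> J"
      using mem_adjoinE[OF J c(2)] by metis
    have "y \<otimes> (u \<ominus> b \<otimes> x) = (y \<otimes> u \<ominus> a \<otimes> x) \<oplus> (a \<ominus> b \<otimes> y) \<otimes> x"
      using a(1) b(1) c u(1) by algebra
    then have "y \<otimes> (u \<ominus> b \<otimes> x) \<in> J"
      using ideal_add[OF J a(2) ideal.I_r_closed[OF J b(2) c(1)]] by simp
    then have "u \<ominus> b \<otimes> x \<in> J"
      using regular_modD[OF y(2)] b(1) c u(1) by simp
    then show False
      using mem_adjoinI[OF J c(1) b(1) u(1)] u(2) by simp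
  qed
  moreover have "t \<otimes> a \<in> Idl (insert y J)" if t: "t \<in> M" for t
  proof -
    have tc: "t \<in> carrier R" using ideal.Icarr[OF M t] .
    obtain b where b: "b \<in> carrier R" "t \<otimes> u \<ominus> b \<otimes> x \<in> J"
      using mem_adjoinE[OF J c(1) u(3)[OF t]] by metis
    have "x \<otimes> (t \<otimes> a \<ominus> b \<otimes> y) = y \<otimes> (t \<otimes> u \<ominus> b \<otimes> x) \<ominus> t \<otimes> (y \<otimes> u \<ominus> a \<otimes> x)"
      using a(1) b(1) c u(1) tc by algebra
    then have "x \<otimes> (t \<otimes> a \<ominus> b \<otimes> y) \<in> J"
      using ideal_diff[OF J ideal.I_l_closed[OF J b(2) c(2)] ideal.I_l_closed[OF J a(2) tc]]
      by simp
    then have "t \<otimes> a \<ominus> b \<otimes> y \<in> J"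
      using regular_modD[OF x(2)] a(1) b(1) c tc by simp
    then show ?thesis
      using mem_adjoinI[OF J c(2) b(1)] a(1) tc by simp
  qed
  ultimately show ?thesis
    unfolding killed_mod_def using a(1) by blast
qed

text \<open>An element regular modulo all initial segments of \<open>xs\<close> can be moved to the front of the sequence,
  again by exchange of neighbours.\<close>
lemma weakly_regular_adjoin_regular:
  assumes "ideal J R" "weakly_regular R J xs"
    "\<And>i. i \<le> length xs \<Longrightarrow> regular_mod R (Idl (J \<union> set (take i xs))) z"
  shows "weakly_regular R (Idl (insert z J)) xs"
  using assms
proof (induction xs arbitrary: J)
  case Nil
  then show ?case by simp
next
  case (Cons x xs)
  have x: "regular_mod R J x" and xs: "weakly_regular R (Idl (insert x J)) xs"
    using Cons.prems(2) by simp_all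
  have c: "x \<in> carrier R" "set xs \<subseteq> carrier R"
    using x xs weakly_regular_in_carrier by (auto dest: regular_mod_carrier)
  have z: "regular_mod R (Idl (Idl (insert x J) \<union> set (take i xs))) z" if "i \<le> length xs" for i
    using Cons.prems(3)[of "Suc i"] that adjoin_Un[OF Cons.prems(1) c(1), of "set (take i xs)"]
      order_trans[OF set_take_subset c(2)] by simp
  have zc: "z \<in> carrier R"
    using z[of 0] by (simp add: regular_mod_carrier)
  have J': "ideal (Idl (insert x J)) R"
    by (rule adjoin_ideal[OF Cons.prems(1) c(1)])
  have "regular_mod R (Idl (insert z J)) x"
    using regular_mod_swap[OF Cons.prems(1) x, of z] z[of 0] Idl_ideal_eq[OF J'] by simp
  moreover have "weakly_regular R (Idl (insert z (Idl (insert x J)))) xs"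
    by (rule Cons.IH[OF J' xs z])
  ultimately show ?case
    using adjoin_swap[OF Cons.prems(1) c(1) zc] by simp
qed

end

context noetherian_cring
begin

text \<open>The primes are the maximal annihilators of nonzero elements of \<open>R/K\<close>. Each annihilator lies in a
  maximal one, so an element outside all of them is regular. For finiteness, let finitely many
  of the elements with maximal annihilator generate the ideal spanned by all of them. The
  annihilator of a further one contains the intersection of finitely many maximal annihilators, hence, being prime,
  one of them, and then equals it.\<close>
lemma finitely_many_primes_cover_zero_divisors:
  assumes K: "ideal K R"
  obtains F where "finite F"
    "\<And>P. P \<in> F \<Longrightarrow> primeideal P R \<and> (\<exists>u\<in>carrier R - K. P = ideal_colon R K {u})"
    "\<And>z. z \<in> carrier R \<Longrightarrow> (\<And>P. P \<in> F \<Longrightarrow> z \<notin> P) \<Longrightarrow> regular_mod R K z"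
proof -
  define ann where "ann u = ideal_colon R K {u}" for u
  have ann_iff: "t \<in> ann u \<longleftrightarrow> t \<in> carrier R \<and> t \<otimes> u \<in> K" for t u
    by (auto simp: ann_def colon_singleton)
  have ann_ideal: "ideal (ann u) R" if "u \<in> carrier R" for u
    using ideal_colon_ideal[OF K, of "{u}"] that by (simp add: ann_def)
  \<comment> \<open>the elements whose annihilator modulo \<open>K\<close> is maximal\<close>
  define U where "U = {u \<in> carrier R - K. \<forall>v\<in>carrier R - K. ann u \<subseteq> ann v \<longrightarrow> ann v = ann u}"
  have Uc: "U \<subseteq> carrier R" by (auto simp: U_def)
  have prime: "primeideal (ann u) R" if u: "u \<in> U" for u
  proof -
    have uc: "u \<in> carrier R" "u \<notin> K" and max: "\<And>v. v \<in> carrier R - K \<Longrightarrow> ann u \<subseteq> ann v \<Longrightarrow> ann v = ann u"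
      using u by (auto simp: U_def)
    show ?thesis
    proof (rule primeidealI[OF ann_ideal[OF uc(1)] is_cring])
      have "\<one> \<notin> ann u" using uc by (simp add: ann_iff)
      then show "carrier R \<noteq> ann u" by blast
      fix a b assume a: "a \<in> carrier R" and b: "b \<in> carrier R" and ab: "a \<otimes> b \<in> ann u"
      show "a \<in> ann u \<or> b \<in> ann u"
      proof (cases "a \<in> ann u")
        case False
        have "ann u \<subseteq> ann (a \<otimes> u)"
          using a uc(1) ideal.I_l_closed[OF K _ a] m_lcomm[OF _ a uc(1)]
          by (auto simp: ann_iff)
        then have "ann (a \<otimes> u) = ann u"
          using max[of "a \<otimes> u"] False a uc(1) by (simp add: ann_iff)
        moreover have "b \<in> ann (a \<otimes> u)"
          using ab a b uc(1) by (simp add: ann_iff m_ac)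
        ultimately show ?thesis by simp
      qed simp
    qed
  qed
  have below: "\<exists>u\<in>U. ann v \<subseteq> ann u" if v: "v \<in> carrier R - K" for v
  proof -
    define G where "G = {ann u |u. u \<in> carrier R - K \<and> ann v \<subseteq> ann u}"
    have "G \<subseteq> {I. ideal I R}" "G \<noteq> {}"
      using v ann_ideal by (auto simp: G_def)
    then obtain P where P: "P \<in> G" "\<And>I. I \<in> G \<Longrightarrow> P \<subseteq> I \<Longrightarrow> I = P"
      by (rule maximal_ideal_in_family) blast
    then obtain u where u: "P = ann u" "u \<in> carrier R - K" "ann v \<subseteq> ann u"
      by (auto simp: G_def)
    have "ann w = ann u" if "w \<in> carrier R - K" "ann u \<subseteq> ann w" for w
      using P(2)[of "ann w"] that u unfolding G_def by blast
    then have "u \<in> U"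
      using u(2) by (auto simp: U_def)
    then show ?thesis using u(3) by blast
  qed
  obtain V where V: "finite V" "V \<subseteq> U" "U \<subseteq> Idl V"
  proof -
    define G where "G = {Idl V |V. finite V \<and> V \<subseteq> U}"
    have "G \<subseteq> {I. ideal I R}" "G \<noteq> {}"
      using Uc genideal_ideal by (auto simp: G_def)
    then obtain N where N: "N \<in> G" "\<And>I. I \<in> G \<Longrightarrow> N \<subseteq> I \<Longrightarrow> I = N"
      by (rule maximal_ideal_in_family) blast
    then obtain V where V: "N = Idl V" "finite V" "V \<subseteq> U"
      by (auto simp: G_def)
    have "u \<in> Idl V" if u: "u \<in> U" for u
    proof -
      have uV: "insert u V \<subseteq> carrier R" using u V(3) Uc by auto
      have "Idl (insert u V) \<in> G"
        using u V(2,3) unfolding G_def by blast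
      moreover have "N \<subseteq> Idl (insert u V)"
        unfolding V(1) using uV by (intro subset_Idl_subset) auto
      ultimately have "Idl (insert u V) = Idl V"
        using N(2) V(1) by blast
      then show ?thesis
        using genideal_self[OF uV] by blast
    qed
    then show ?thesis using that V by blast
  qed
  have Vc: "V \<subseteq> carrier R" using V(2) Uc by blast
  have ann_in: "ann u \<in> ann ` V" if u: "u \<in> U" for u
  proof (rule ccontr)
    assume not_in: "ann u \<notin> ann ` V"
    have uc: "u \<in> carrier R - K" using u by (simp add: U_def)
    have "\<not> ann v \<subseteq> ann u" if v: "v \<in> V" for v
    proof
      assume "ann v \<subseteq> ann u"
      moreover have "v \<in> U" using v V(2) by blast
      ultimately have "ann u = ann v" using uc by (simp add: U_def)
      then show False using not_in v by blast
    qed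
    moreover have "\<not> carrier R \<subseteq> ann u"
      using uc one_closed by (auto simp: ann_iff)
    ultimately have "\<exists>t\<in>carrier R. t \<notin> ann u \<and> (\<forall>Q\<in>ann ` V. t \<in> Q)"
      using V(1) Vc ann_ideal by (intro prime_not_containing_Int[OF prime[OF u] oneideal]) auto
    then obtain t where t: "t \<in> carrier R" "t \<notin> ann u" "\<And>v. v \<in> V \<Longrightarrow> t \<in> ann v"
      by blast
    have "v \<otimes> t \<in> K \<and> v \<in> carrier R" if "v \<in> V" for v
      using t(3)[OF that] m_comm[OF t(1), of v] Vc that by (auto simp: ann_iff)
    then have "V \<subseteq> ideal_colon R K {t}"
      by (auto simp: colon_singleton)
    then have "Idl V \<subseteq> ideal_colon R K {t}"
      using ideal_colon_ideal[OF K, of "{t}"] t(1) by (intro genideal_minimal) auto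
    then have "u \<in> ideal_colon R K {t}"
      using V(3) u by blast
    then show False
      using t(1,2) uc m_comm[OF t(1), of u] by (simp add: colon_singleton ann_iff)
  qed
  show ?thesis
  proof (rule that[of "ann ` V"])
    show "finite (ann ` V)" using V(1) by simp
    show "primeideal P R \<and> (\<exists>u\<in>carrier R - K. P = ideal_colon R K {u})" if P: "P \<in> ann ` V" for P
    proof -
      obtain v where v: "v \<in> U" "P = ann v" using P V(2) by blast
      then have "v \<in> carrier R - K" by (simp add: U_def)
      then show ?thesis using prime[OF v(1)] v(2) ann_def by blast
    qed
    show "regular_mod R K z" if z: "z \<in> carrier R" "\<And>P. P \<in> ann ` V \<Longrightarrow> z \<notin> P" for z
    proof -
      have "b \<in> K" if b: "b \<in> carrier R" "z \<otimes> b \<in> K" for b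
      proof (rule ccontr)
        assume "b \<notin> K"
        then obtain u where u: "u \<in> U" "ann b \<subseteq> ann u"
          using below b(1) by blast
        have "z \<in> ann b"
          using z(1) b(2) by (simp add: ann_iff)
        then show False
          using z(2)[OF ann_in[OF u(1)]] u(2) by blast
      qed
      then show ?thesis
        using z(1) by (simp add: regular_mod_def)
    qed
  qed
qed

text \<open>An ideal contained in a prime annihilator kills the element that defines it, so this is prime
  avoidance for the finitely many primes that cover the zero divisors modulo the members of
  \<open>\<K>\<close>. Covering several ideals at once is what the comparison of two regular sequences needs.\<close>
lemma common_regular_element:
  assumes M: "ideal M R" and fin: "finite \<K>"
    and K: "\<And>K. K \<in> \<K> \<Longrightarrow> ideal K R \<and> \<not> killed_mod R M K"
  shows "\<exists>z\<in>M. \<forall>K\<in>\<K>. regular_mod R K z"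
proof -
  have "\<exists>F. finite F \<and>
      (\<forall>P\<in>F. primeideal P R \<and> (\<exists>u\<in>carrier R - K. P = ideal_colon R K {u})) \<and>
      (\<forall>z\<in>carrier R. (\<forall>P\<in>F. z \<notin> P) \<longrightarrow> regular_mod R K z)" if K_in: "K \<in> \<K>" for K
  proof -
    obtain F where "finite F"
      "\<And>P. P \<in> F \<Longrightarrow> primeideal P R \<and> (\<exists>u\<in>carrier R - K. P = ideal_colon R K {u})"
      "\<And>z. z \<in> carrier R \<Longrightarrow> (\<And>P. P \<in> F \<Longrightarrow> z \<notin> P) \<Longrightarrow> regular_mod R K z"
      using finitely_many_primes_cover_zero_divisors[OF conjunct1[OF K[OF K_in]]] by metis
    then show ?thesis
      by (intro exI[of _ F]) simp
  qed
  then obtain F where F: "\<And>K. K \<in> \<K> \<Longrightarrow> finite (F K)"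
    "\<And>K P. K \<in> \<K> \<Longrightarrow> P \<in> F K \<Longrightarrow> primeideal P R \<and> (\<exists>u\<in>carrier R - K. P = ideal_colon R K {u})"
    "\<And>K z. K \<in> \<K> \<Longrightarrow> z \<in> carrier R \<Longrightarrow> (\<forall>P\<in>F K. z \<notin> P) \<Longrightarrow> regular_mod R K z"
    by metis
  have "\<exists>z\<in>M. \<forall>P\<in>(\<Union>K\<in>\<K>. F K). z \<notin> P"
  proof (rule prime_avoidance[OF M])
    show "finite (\<Union>K\<in>\<K>. F K)" using fin F(1) by blast
    fix P assume "P \<in> (\<Union>K\<in>\<K>. F K)"
    then obtain K' where K': "K' \<in> \<K>" "P \<in> F K'" by blast
    obtain u where "u \<in> carrier R - K'" "P = ideal_colon R K' {u}"
      using F(2)[OF K'] by blast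
    then have "\<not> M \<subseteq> P"
      using K[OF K'(1)] unfolding killed_mod_def by (auto simp: colon_singleton)
    then show "primeideal P R \<and> \<not> M \<subseteq> P"
      using F(2)[OF K'] by blast
  qed
  then obtain z where "z \<in> M" "\<And>K P. K \<in> \<K> \<Longrightarrow> P \<in> F K \<Longrightarrow> z \<notin> P" by blast
  then show ?thesis
    using F(3) ideal.Icarr[OF M] by blast
qed

lemma weakly_regular_take_not_killed:
  assumes "ideal J R" "weakly_regular R J xs" "set xs \<subseteq> M" "i < length xs"
  shows "\<not> killed_mod R M (Idl (J \<union> set (take i xs)))"
  using weakly_regular_iff_nth[OF assms(1) weakly_regular_in_carrier[OF assms(2)]] assms
  by (intro regular_mod_imp_not_killed[of _ "xs ! i"]) auto

text \<open>Both sequences are compared through one element \<open>z\<close> of \<open>M\<close> that is regular modulo every proper initial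
  segment of either. The exchange lemma replaces the last element \<open>x\<close> by \<open>z\<close>, and \<open>z\<close> moves to the front; the
  shorter sequences are compared modulo \<open>(J, z)\<close> by the induction hypothesis; then \<open>z\<close> moves back
  and is exchanged for \<open>y\<close>.\<close>
lemma killed_mod_invariant:
  assumes "ideal J R" and M: "ideal M R"
    and "weakly_regular R J xs" "set xs \<subseteq> M"
    and "weakly_regular R J ys" "set ys \<subseteq> M" and "length xs = length ys"
    and "killed_mod R M (Idl (J \<union> set xs))"
  shows "killed_mod R M (Idl (J \<union> set ys))"
  using assms(1,3-)
proof (induction xs arbitrary: J ys rule: rev_induct)
  case Nil
  then show ?case by simp
next
  case (snoc x xs)
  note J = snoc.prems(1)
  obtain y ys' where ys: "ys = ys' @ [y]"
    using snoc.prems(6) by (cases ys rule: rev_cases) auto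
  have len: "length xs = length ys'"
    using snoc.prems(6) ys by simp
  have M_sub: "set xs \<subseteq> M" "x \<in> M" "set ys' \<subseteq> M" "y \<in> M"
    using snoc.prems(3,5) ys by auto
  then have c: "set xs \<subseteq> carrier R" "x \<in> carrier R" "set ys' \<subseteq> carrier R" "y \<in> carrier R"
    using ideal_subset_carrier[OF M] by auto
  have x: "weakly_regular R J xs" "regular_mod R (Idl (J \<union> set xs)) x"
    using snoc.prems(2) weakly_regular_append[OF J c(1), of "[x]"] by simp_all
  have y: "weakly_regular R J ys'" "regular_mod R (Idl (J \<union> set ys')) y"
    using snoc.prems(4) weakly_regular_append[OF J c(3), of "[y]"] ys by simp_all
  define \<K> where "\<K> = (\<lambda>i. Idl (J \<union> set (take i xs))) ` {..length xs} \<union>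
      (\<lambda>i. Idl (J \<union> set (take i ys'))) ` {..length ys'}"
  have "\<exists>z\<in>M. \<forall>K\<in>\<K>. regular_mod R K z"
  proof (rule common_regular_element[OF M])
    show "finite \<K>" by (simp add: \<K>_def)
    have 1: "ideal (Idl (J \<union> set (take i xs))) R \<and> \<not> killed_mod R M (Idl (J \<union> set (take i xs)))"
      if "i \<le> length xs" for i
      using weakly_regular_take_not_killed[OF J snoc.prems(2,3), of i] that
        order_trans[OF set_take_subset c(1)] by (simp add: Un_ideal[OF J])
    have 2: "ideal (Idl (J \<union> set (take i ys'))) R \<and> \<not> killed_mod R M (Idl (J \<union> set (take i ys')))"
      if "i \<le> length ys'" for i
      using weakly_regular_take_not_killed[OF J snoc.prems(4,5), of i] that ys
        order_trans[OF set_take_subset c(3)] by (simp add: Un_ideal[OF J])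
    show "ideal K R \<and> \<not> killed_mod R M K" if "K \<in> \<K>" for K
      using that 1 2 unfolding \<K>_def by blast
  qed
  then obtain z where z: "z \<in> M" "\<And>K. K \<in> \<K> \<Longrightarrow> regular_mod R K z" by blast
  have zx: "regular_mod R (Idl (J \<union> set (take i xs))) z" if "i \<le> length xs" for i
    using that by (intro z(2)) (auto simp: \<K>_def)
  have zy: "regular_mod R (Idl (J \<union> set (take i ys'))) z" if "i \<le> length ys'" for i
    using that by (intro z(2)) (auto simp: \<K>_def)
  have zc: "z \<in> carrier R" using ideal.Icarr[OF M z(1)] .
  have "killed_mod R M (Idl (insert x (Idl (J \<union> set xs))))"
    using snoc.prems(7) adjoin_Idl_Un[OF J c(2,1)] by simp
  then have "killed_mod R M (Idl (insert z (Idl (J \<union> set xs))))"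
    using zx[of "length xs"] z(1) M_sub x(2)
    by (intro killed_mod_exchange[OF Un_ideal[OF J c(1)] M, of x z]) auto
  then have "killed_mod R M (Idl (Idl (insert z J) \<union> set xs))"
    using adjoin_Idl_Un[OF J zc c(1)] adjoin_Un[OF J zc c(1)] by simp
  then have "killed_mod R M (Idl (Idl (insert z J) \<union> set ys'))"
    by (intro snoc.IH[OF adjoin_ideal[OF J zc] weakly_regular_adjoin_regular[OF J x(1) zx] M_sub(1)
          weakly_regular_adjoin_regular[OF J y(1) zy] M_sub(3) len])
  then have "killed_mod R M (Idl (insert z (Idl (J \<union> set ys'))))"
    using adjoin_Idl_Un[OF J zc c(3)] adjoin_Un[OF J zc c(3)] by simp
  then have "killed_mod R M (Idl (insert y (Idl (J \<union> set ys'))))"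
    using zy[of "length ys'"] z(1) M_sub y(2)
    by (intro killed_mod_exchange[OF Un_ideal[OF J c(3)] M, of z y]) auto
  then show ?case
    using adjoin_Idl_Un[OF J c(4,3)] ys by simp
qed

text \<open>If no \<open>z\<close> existed, \<open>M\<close> would kill a nonzero element modulo \<open>xs\<close>, hence modulo the initial segment of
  \<open>ys\<close> of the same length. The next element of \<open>ys\<close> contradicts this.\<close>
lemma weakly_regular_extend:
  assumes J: "ideal J R" and M: "ideal M R"
    and xs: "weakly_regular R J xs" "set xs \<subseteq> M"
    and ys: "weakly_regular R J ys" "set ys \<subseteq> M" and len: "length xs < length ys"
  shows "\<exists>z\<in>M. regular_mod R (Idl (J \<union> set xs)) z"
proof -
  define zs where "zs = take (length xs) ys"
  have c: "set ys \<subseteq> carrier R"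
    by (rule weakly_regular_in_carrier[OF ys(1)])
  have zs: "weakly_regular R J zs" "set zs \<subseteq> M" "length xs = length zs"
  proof -
    have "set zs \<subseteq> set ys" by (simp add: zs_def set_take_subset)
    then show "set zs \<subseteq> M" using ys(2) by blast
    show "weakly_regular R J zs"
      using weakly_regular_append[OF J order_trans[OF \<open>set zs \<subseteq> set ys\<close> c], of "drop (length xs) ys"]
        ys(1) by (simp add: zs_def)
  qed (use len in \<open>simp add: zs_def\<close>)
  have "\<not> killed_mod R M (Idl (J \<union> set zs))"
    using weakly_regular_take_not_killed[OF J ys len] by (simp add: zs_def)
  then have "\<not> killed_mod R M (Idl (J \<union> set xs))"
    using killed_mod_invariant[OF J M xs zs(1,2,3)] by blast
  then show ?thesis
    using common_regular_element[OF M, of "{Idl (J \<union> set xs)}"]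
      Un_ideal[OF J weakly_regular_in_carrier[OF xs(1)]] by auto
qed

end


section \<open>Local rings and saturation\<close>

sublocale local_ring \<subseteq> noetherian_cring ..

context local_ring
begin

lemma max_ideal_maximal: "maximalideal (max_ideal R) R"
  unfolding max_ideal_def using unique_maximalideal by (rule theI')

lemma max_ideal_ideal: "ideal (max_ideal R) R"
  using max_ideal_maximal maximalideal.axioms(1) by blast

lemma max_ideal_prime: "primeideal (max_ideal R) R"
  by (rule maximalideal_prime[OF max_ideal_maximal])

lemma proper_ideal_subset_max_ideal:
  assumes "ideal I R" "I \<noteq> carrier R"
  shows "I \<subseteq> max_ideal R"
proof -
  define F where "F = {K. ideal K R \<and> I \<subseteq> K \<and> K \<noteq> carrier R}"
  have "F \<subseteq> {I. ideal I R}" "F \<noteq> {}"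
    using assms by (auto simp: F_def)
  then obtain K where K: "K \<in> F" "\<And>L. L \<in> F \<Longrightarrow> K \<subseteq> L \<Longrightarrow> L = K"
    by (rule maximal_ideal_in_family) blast
  then have KI: "ideal K R" "I \<subseteq> K" "K \<noteq> carrier R"
    by (simp_all add: F_def)
  have "maximalideal K R"
  proof (rule maximalidealI[OF KI(1)])
    show "carrier R \<noteq> K" using KI(3) by simp
    show "L = K \<or> L = carrier R" if "ideal L R" "K \<subseteq> L" "L \<subseteq> carrier R" for L
      using K(2)[of L] that KI(2) by (auto simp: F_def)
  qed
  then have "K = max_ideal R"
    using unique_maximalideal max_ideal_maximal by blast
  then show ?thesis using KI(2) by simp
qed

lemma saturation_in_carrier: "saturation R K \<subseteq> carrier R"
  by (auto simp: saturation_def ideal_colon_def)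

lemma saturation_mono: "K \<subseteq> L \<Longrightarrow> saturation R K \<subseteq> saturation R L"
  unfolding saturation_def ideal_colon_def by blast

text \<open>If \<open>z\<close> multiplies a power of the maximal ideal into \<open>K\<close>, it multiplies a power of \<open>y\<close> into \<open>K\<close>,
  and \<open>y\<close> can be cancelled.\<close>
lemma saturation_eq_self:
  assumes K: "ideal K R" and y: "y \<in> max_ideal R" "regular_mod R K y"
  shows "saturation R K = K"
proof (rule subset_antisym)
  show "saturation R K \<subseteq> K"
  proof
    fix z assume "z \<in> saturation R K"
    then obtain i :: nat where z: "z \<in> carrier R"
      "\<And>s. s \<in> max_ideal R [^]\<^bsub>ideals_set R\<^esub> i \<Longrightarrow> z \<otimes> s \<in> K"
      by (auto simp: saturation_def ideal_colon_def)
    have "z \<otimes> y [^] i \<in> K"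
      by (rule z(2)[OF pow_mem_ideal_power[OF max_ideal_ideal y(1)]])
    then show "z \<in> K"
      using regular_modD[OF regular_mod_pow[OF y(2)] z(1), of i] m_comm[OF z(1), of "y [^] i"]
        regular_mod_carrier[OF y(2)] by simp
  qed
  have "ideal_colon R K (max_ideal R) \<subseteq> saturation R K"
    unfolding saturation_def
    using UN_upper[of "1::nat" "{1..}" "\<lambda>i. ideal_colon R K (max_ideal R [^]\<^bsub>ideals_set R\<^esub> i)"]
      ideal_power_one[OF max_ideal_ideal] by simp
  moreover have "K \<subseteq> ideal_colon R K (max_ideal R)"
    using ideal.I_r_closed[OF K] ideal.Icarr[OF K] ideal.Icarr[OF max_ideal_ideal]
    by (auto simp: ideal_colon_def)
  ultimately show "K \<subseteq> saturation R K" by blast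
qed

lemma saturation_eq_carrier:
  assumes I: "ideal I R" and "\<And>P. primeideal P R \<Longrightarrow> I \<subseteq> P \<Longrightarrow> P = max_ideal R"
  shows "saturation R I = carrier R"
proof -
  obtain k :: nat where k: "k \<ge> 1" "max_ideal R [^]\<^bsub>ideals_set R\<^esub> k \<subseteq> I"
    using ideal_power_subset[OF max_ideal_prime I] assms(2) by blast
  have "carrier R \<subseteq> ideal_colon R I (max_ideal R [^]\<^bsub>ideals_set R\<^esub> k)"
    using k(2) ideal.I_l_closed[OF I] by (auto simp: ideal_colon_def)
  then show ?thesis
    using k(1) saturation_in_carrier[of I] unfolding saturation_def by auto
qed

text \<open>The chain of primes that a regular sequence produces below \<open>P\<close> becomes longer by one when the maximal
  ideal is put on top.\<close>
lemma regular_length_less_krull_dim: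
  assumes "weakly_regular R {\<zero>} xs" "primeideal P R" "set xs \<subseteq> P" "P \<noteq> max_ideal R"
  shows "enat (Suc (length xs)) \<le> krull_dim R"
proof -
  have PI: "ideal P R" "P \<noteq> carrier R"
    using assms(2) primeideal.axioms(1) primeideal.I_notcarr by blast+
  then have "{\<zero>} \<union> set xs \<subseteq> P"
    using assms(3) additive_subgroup.zero_closed[OF ideal.axioms(1)[OF PI(1)]] by simp
  then obtain C where C: "\<forall>i\<le>length xs. primeideal (C i) R"
    "\<forall>i<length xs. C i \<subset> C (Suc i)" "C (length xs) = P"
    using prime_chain_below[OF zeroideal assms(1,2)] by blast
  define C' where "C' = C(Suc (length xs) := max_ideal R)"
  have "P \<subset> max_ideal R"
    using proper_ideal_subset_max_ideal[OF PI] assms(4) by blast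
  then have "(\<forall>i\<le>Suc (length xs). primeideal (C' i) R) \<and> (\<forall>i<Suc (length xs). C' i \<subset> C' (Suc i))"
    using C max_ideal_prime by (auto simp: C'_def le_Suc_eq less_Suc_eq)
  then show ?thesis
    unfolding krull_dim_def by (intro Sup_upper) blast
qed

end

text \<open>A positive finite supremum of extended naturals is attained.\<close>
lemma long_regular_sequence_if_depth:
  assumes "depth R = enat d" "m < d"
  obtains xs where "regular_sequence R xs" "set xs \<subseteq> max_ideal R" "m < length xs"
proof (rule ccontr)
  assume "\<not> thesis"
  then have "length xs \<le> m" if "regular_sequence R xs" "set xs \<subseteq> max_ideal R" for xs
    using that \<open>\<And>xs. _ \<Longrightarrow> _ \<Longrightarrow> _ \<Longrightarrow> thesis\<close> by (meson not_le)
  then have "depth R \<le> enat m"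
    unfolding depth_def by (intro Sup_least) auto
  then show False
    using assms by simp
qed


section \<open>Quotients of local rings\<close>

text \<open>Working with an arbitrary surjection keeps the cosets of a quotient ring out of the arguments.\<close>
locale surjective_cring_hom = ring_hom_cring R S h for R (structure) and S (structure) and h +
  assumes surjective: "h ` carrier R = carrier S"
begin

definition preimage :: "'c set \<Rightarrow> 'a set"
  where "preimage I = {r \<in> carrier R. h r \<in> I}"

lemma preimage_mem_iff: "r \<in> carrier R \<Longrightarrow> r \<in> preimage I \<longleftrightarrow> h r \<in> I"
  by (simp add: preimage_def)

lemma preimage_ideal: "ideal I S \<Longrightarrow> ideal (preimage I) R"
  unfolding preimage_def by (rule ring.ideal_vimage)

lemma image_preimage: "I \<subseteq> carrier S \<Longrightarrow> h ` preimage I = I"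
  using surjective by (auto simp: preimage_def)

lemma preimage_zero_subset: "ideal I S \<Longrightarrow> preimage {\<zero>\<^bsub>S\<^esub>} \<subseteq> preimage I"
  using additive_subgroup.zero_closed[OF ideal.axioms(1)] by (auto simp: preimage_def)

lemma image_ideal:
  assumes J: "ideal J R"
  shows "ideal (h ` J) S"
proof (rule idealI[OF S.ring_axioms])
  show "subgroup (h ` J) (add_monoid S)"
    by (rule ring.img_is_add_subgroup[OF additive_subgroup.a_subgroup[OF ideal.axioms(1)[OF J]]])
  have closed: "x \<otimes>\<^bsub>S\<^esub> a \<in> h ` J" if a: "a \<in> h ` J" and x: "x \<in> carrier S" for a x
  proof -
    obtain j r where "j \<in> J" "a = h j" "r \<in> carrier R" "x = h r"
      using a x surjective by blast
    then show ?thesis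
      using imageI[OF ideal.I_l_closed[OF J, of j r], of h] ideal.Icarr[OF J, of j] by simp
  qed
  then show "x \<otimes>\<^bsub>S\<^esub> a \<in> h ` J" if "a \<in> h ` J" "x \<in> carrier S" for a x
    using that by blast
  show "a \<otimes>\<^bsub>S\<^esub> x \<in> h ` J" if a: "a \<in> h ` J" and x: "x \<in> carrier S" for a x
    using closed[OF that] S.m_comm[of a x] x a ideal.Icarr[OF J] by auto
qed

lemma preimage_image:
  assumes J: "ideal J R" and ker: "preimage {\<zero>\<^bsub>S\<^esub>} \<subseteq> J"
  shows "preimage (h ` J) = J"
proof (rule subset_antisym)
  show "J \<subseteq> preimage (h ` J)"
    using ideal.Icarr[OF J] by (auto simp: preimage_def)
  show "preimage (h ` J) \<subseteq> J"
  proof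
    fix r assume "r \<in> preimage (h ` J)"
    then obtain j where j: "r \<in> carrier R" "j \<in> J" "h r = h j"
      by (auto simp: preimage_def)
    then have jc: "j \<in> carrier R" using ideal.Icarr[OF J] by blast
    have "h (r \<ominus> j) = \<zero>\<^bsub>S\<^esub>"
      using j jc by (simp add: R.minus_eq S.r_neg)
    then have "r \<ominus> j \<in> J"
      using ker j(1) jc by (auto simp: preimage_def)
    then have "(r \<ominus> j) \<oplus> j \<in> J"
      using R.ideal_add[OF J _ j(2)] by blast
    moreover have "(r \<ominus> j) \<oplus> j = r"
      using j(1) jc by algebra
    ultimately show "r \<in> J" by simp
  qed
qed

lemma regular_mod_preimage_iff:
  assumes "a \<in> carrier R"
  shows "regular_mod S I (h a) \<longleftrightarrow> regular_mod R (preimage I) a"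
  using assms unfolding regular_mod_def surjective[symmetric] by (auto simp: preimage_def)

lemma preimage_adjoin:
  assumes I: "ideal I S" and a: "a \<in> carrier R"
  shows "preimage (Idl\<^bsub>S\<^esub> (insert (h a) I)) = Idl (insert a (preimage I))"
proof (rule subset_antisym)
  have pI: "ideal (preimage I) R" by (rule preimage_ideal[OF I])
  have ha: "h a \<in> carrier S" using a by simp
  show "preimage (Idl\<^bsub>S\<^esub> (insert (h a) I)) \<subseteq> Idl (insert a (preimage I))"
  proof
    fix r assume "r \<in> preimage (Idl\<^bsub>S\<^esub> (insert (h a) I))"
    then have r: "r \<in> carrier R" "h r \<in> Idl\<^bsub>S\<^esub> (insert (h a) I)"
      by (auto simp: preimage_def)
    obtain s' where s': "s' \<in> carrier S" "h r \<ominus>\<^bsub>S\<^esub> s' \<otimes>\<^bsub>S\<^esub> h a \<in> I"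
      using S.mem_adjoinE[OF I ha r(2)] by metis
    then obtain s where s: "s \<in> carrier R" "s' = h s"
      using surjective by blast
    have "h (r \<ominus> s \<otimes> a) = h r \<ominus>\<^bsub>S\<^esub> s' \<otimes>\<^bsub>S\<^esub> h a"
      using r(1) s a by (simp add: R.minus_eq S.minus_eq)
    then have "r \<ominus> s \<otimes> a \<in> preimage I"
      using s' r(1) s a by (simp add: preimage_def)
    then show "r \<in> Idl (insert a (preimage I))"
      by (rule R.mem_adjoinI[OF pI a s(1) r(1)])
  qed
  have "insert a (preimage I) \<subseteq> preimage (Idl\<^bsub>S\<^esub> (insert (h a) I))"
    using S.adjoin_subset[OF I ha] a by (auto simp: preimage_def)
  then show "Idl (insert a (preimage I)) \<subseteq> preimage (Idl\<^bsub>S\<^esub> (insert (h a) I))"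
    by (intro R.genideal_minimal preimage_ideal S.adjoin_ideal[OF I ha])
qed

lemma weakly_regular_preimage_iff:
  assumes "ideal I S" "set xs \<subseteq> carrier R"
  shows "weakly_regular S I (map h xs) \<longleftrightarrow> weakly_regular R (preimage I) xs"
  using assms
proof (induction xs arbitrary: I)
  case Nil
  then show ?case by simp
next
  case (Cons x xs)
  then show ?case
    using Cons.IH[OF S.adjoin_ideal[OF Cons.prems(1), of "h x"]]
      preimage_adjoin[OF Cons.prems(1), of x] regular_mod_preimage_iff[of x I] by simp
qed

lemma preimage_prime:
  assumes P: "primeideal P S"
  shows "primeideal (preimage P) R"
proof (rule primeidealI[OF preimage_ideal[OF primeideal.axioms(1)[OF P]] R.is_cring])
  have "\<one>\<^bsub>S\<^esub> \<notin> P"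
    using primeideal.I_notcarr[OF P] ideal.one_imp_carrier[OF primeideal.axioms(1)[OF P]] by blast
  then have "\<one> \<notin> preimage P"
    by (simp add: preimage_def)
  then show "carrier R \<noteq> preimage P"
    using R.one_closed by blast
  show "a \<in> preimage P \<or> b \<in> preimage P"
    if "a \<in> carrier R" "b \<in> carrier R" "a \<otimes> b \<in> preimage P" for a b
    using that primeideal.I_prime[OF P, of "h a" "h b"] by (simp add: preimage_def)
qed

lemma lift_list:
  assumes "set ys \<subseteq> carrier S"
  obtains xs where "set xs \<subseteq> carrier R" "ys = map h xs"
proof -
  have "ys \<in> lists (h ` carrier R)"
    using assms surjective by auto
  then show ?thesis
    using that by (auto simp: lists_image)
qed

lemma noetherian_image:
  assumes "noetherian_ring R"
  shows "noetherian_ring S"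
proof (rule S.noetherian_ringI)
  fix I assume I: "ideal I S"
  obtain A where A: "A \<subseteq> carrier R" "finite A" "preimage I = Idl A"
    using noetherian_ring.finetely_gen[OF assms preimage_ideal[OF I]] by blast
  have Ic: "I \<subseteq> carrier S" by (rule S.ideal_subset_carrier[OF I])
  have hA: "h ` A \<subseteq> carrier S" using A(1) by auto
  have "A \<subseteq> preimage I"
    using R.genideal_self[OF A(1)] A(3) by simp
  then have "h ` A \<subseteq> I" by (auto simp: preimage_def)
  then have "Idl\<^bsub>S\<^esub> (h ` A) \<subseteq> I"
    by (rule S.genideal_minimal[OF I])
  moreover have "preimage I \<subseteq> preimage (Idl\<^bsub>S\<^esub> (h ` A))"
    unfolding A(3) using A(1) S.genideal_self[OF hA]
    by (intro R.genideal_minimal preimage_ideal S.genideal_ideal[OF hA]) (auto simp: preimage_def)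
  then have "h ` preimage I \<subseteq> h ` preimage (Idl\<^bsub>S\<^esub> (h ` A))" by blast
  then have "I \<subseteq> Idl\<^bsub>S\<^esub> (h ` A)"
    using image_preimage[OF Ic] image_preimage[OF S.ideal_subset_carrier[OF S.genideal_ideal[OF hA]]]
    by simp
  ultimately show "\<exists>A\<subseteq>carrier S. finite A \<and> I = Idl\<^bsub>S\<^esub> A"
    using A(2) hA by blast
qed

lemma preimage_eq_iff:
  assumes "I \<subseteq> carrier S" "K \<subseteq> carrier S"
  shows "preimage I = preimage K \<longleftrightarrow> I = K"
  using image_preimage assms by metis

lemma preimage_carrier: "preimage (carrier S) = carrier R"
  by (auto simp: preimage_def)

lemma local_ring_image:
  assumes "local_ring R" and proper: "preimage {\<zero>\<^bsub>S\<^esub>} \<noteq> carrier R"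
  shows "local_ring S" "preimage (max_ideal S) = max_ideal R"
proof -
  interpret R: local_ring R by fact
  let ?m = "max_ideal R"
  have "preimage {\<zero>\<^bsub>S\<^esub>} \<subseteq> ?m"
    by (rule R.proper_ideal_subset_max_ideal[OF preimage_ideal[OF S.zeroideal] proper])
  then have pre_m: "preimage (h ` ?m) = ?m"
    by (rule preimage_image[OF R.max_ideal_ideal])
  have m: "ideal (h ` ?m) S" by (rule image_ideal[OF R.max_ideal_ideal])
  have proper_sub: "I \<subseteq> h ` ?m" if I: "ideal I S" "I \<noteq> carrier S" for I
  proof -
    have "preimage I \<noteq> carrier R"
      using preimage_eq_iff[OF S.ideal_subset_carrier[OF I(1)] order_refl] I(2) preimage_carrier
      by simp
    then have "h ` preimage I \<subseteq> h ` ?m"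
      using R.proper_ideal_subset_max_ideal[OF preimage_ideal[OF I(1)]] by blast
    then show ?thesis
      using image_preimage[OF S.ideal_subset_carrier[OF I(1)]] by simp
  qed
  have m_ne: "h ` ?m \<noteq> carrier S"
    using pre_m preimage_carrier maximalideal.I_notcarr[OF R.max_ideal_maximal] by metis
  have max: "maximalideal (h ` ?m) S"
  proof (rule maximalidealI[OF m])
    show "carrier S \<noteq> h ` ?m" using m_ne by simp
    show "L = h ` ?m \<or> L = carrier S" if "ideal L S" "h ` ?m \<subseteq> L" "L \<subseteq> carrier S" for L
      using proper_sub[OF that(1)] that(2) by blast
  qed
  have unique: "M = h ` ?m" if M: "maximalideal M S" for M
  proof -
    have "M \<noteq> carrier S" "ideal M S"
      using M maximalideal.I_notcarr maximalideal.axioms(1) by blast+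
    then show ?thesis
      using proper_sub maximalideal.I_maximal[OF M m] S.ideal_subset_carrier[OF m] m_ne by blast
  qed
  interpret S_noeth: noetherian_ring S
    using noetherian_image R.noetherian_ring_axioms by blast
  show local: "local_ring S"
    by unfold_locales (use max unique in blast)
  show "preimage (max_ideal S) = ?m"
    using unique[OF local_ring.max_ideal_maximal[OF local]] pre_m by simp
qed

lemma mem_nilradical_iff:
  assumes "a \<in> carrier R"
  shows "h a \<in> nilradical S \<longleftrightarrow> (\<exists>k::nat. a [^] k \<in> preimage {\<zero>\<^bsub>S\<^esub>})"
  using assms by (simp add: nilradical_def ideal_radical_def preimage_def ring.hom_nat_pow)

end

lemma (in cring) Quot_surjective_cring_hom:
  assumes "ideal J R"
  shows "surjective_cring_hom R (R Quot J) ((+>) J)"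
proof (intro surjective_cring_hom.intro surjective_cring_hom_axioms.intro)
  show "ring_hom_cring R (R Quot J) ((+>) J)"
    by (rule ideal.rcos_ring_hom_cring[OF assms is_cring])
  show "(+>) J ` carrier R = carrier (R Quot J)"
    by (auto simp: FactRing_def A_RCOSETS_def')
qed

lemma (in cring) Quot_preimage_zero:
  assumes "ideal J R"
  shows "surjective_cring_hom.preimage R ((+>) J) {\<zero>\<^bsub>R Quot J\<^esub>} = J"
proof -
  interpret J: ideal J R by fact
  have "J +> a = \<zero>\<^bsub>R Quot J\<^esub> \<longleftrightarrow> a \<in> J" if "a \<in> carrier R" for a
    using that J.a_rcos_const J.rcos_const_imp_mem by (auto simp: FactRing_def)
  then have "{a \<in> carrier R. J +> a \<in> {\<zero>\<^bsub>R Quot J\<^esub>}} = J"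
    using J.Icarr by blast
  then show ?thesis
    by (simp add: surjective_cring_hom.preimage_def[OF Quot_surjective_cring_hom[OF assms]])
qed


section \<open>Weak reducedness\<close>

theorem proposition6p5:
  fixes A :: "('a, 'b) ring_scheme"
    and d :: nat
    and \<mu> :: "'a list"
    and n :: "nat list"
  assumes "cohen_macaulay_local_ring A"
    and "krull_dim A = enat d"
    and "d \<ge> 2"
    and "length \<mu> = d - 2"
    and "regular_sequence A \<mu>"
    and "radical_ideal A (Idl\<^bsub>A\<^esub> (set \<mu>))"
    and "length n = d - 2"
    and "\<forall>k\<in>set n. k \<ge> 2"
  shows "weakly_reduced (A Quot (Idl\<^bsub>A\<^esub> (set (map2 (\<lambda>x k. x [^]\<^bsub>A\<^esub> k) \<mu> n))))"
proof -
  interpret A: local_ring A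
    using assms(1) by (simp add: cohen_macaulay_local_ring_def)
  define \<nu> where "\<nu> = map2 (\<lambda>x k. x [^]\<^bsub>A\<^esub> k) \<mu> n"
  define J where "J = Idl\<^bsub>A\<^esub> (set \<nu>)"
  define Q where "Q = A Quot J"
  define N where "N = Idl\<^bsub>A\<^esub> (set \<mu>)"
  let ?m = "max_ideal A"
  have \<mu>: "set \<mu> \<subseteq> carrier A" "weakly_regular A {\<zero>\<^bsub>A\<^esub>} \<mu>" "N \<noteq> carrier A"
    using assms(5) by (auto simp: A.regular_sequence_iff N_def)
  have \<nu>: "set \<nu> \<subseteq> carrier A" "length \<nu> = d - 2"
    using \<mu>(1) assms(4,7) by (auto simp: \<nu>_def dest!: set_zip_leftD)
  have len_n: "length n = length \<mu>" and n0: "0 \<notin> set n"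
    using assms(4,7,8) by auto
  have J: "ideal J A" and N: "ideal N A"
    using \<mu>(1) \<nu>(1) by (auto simp: J_def N_def intro: A.genideal_ideal)
  have \<mu>N: "set \<mu> \<subseteq> N"
    using A.genideal_self[OF \<mu>(1)] by (simp add: N_def)
  have "x [^]\<^bsub>A\<^esub> k \<in> N" if "(x, k) \<in> set (zip \<mu> n)" for x k
  proof (rule A.mem_ideal_pow[OF N])
    show "x \<in> N" using set_zip_leftD[OF that] \<mu>N by blast
    show "k \<noteq> 0" using set_zip_rightD[OF that] n0 by metis
  qed
  then have "J \<subseteq> N"
    unfolding J_def by (intro A.genideal_minimal[OF N]) (auto simp: \<nu>_def)
  have "N \<subseteq> ?m"
    by (rule A.proper_ideal_subset_max_ideal[OF N \<mu>(3)])
  have J_zero: "Idl\<^bsub>A\<^esub> ({\<zero>\<^bsub>A\<^esub>} \<union> set \<nu>) = J" and N_zero: "Idl\<^bsub>A\<^esub> ({\<zero>\<^bsub>A\<^esub>} \<union> set \<mu>) = N"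
    using A.Idl_insert_zero[OF \<nu>(1)] A.Idl_insert_zero[OF \<mu>(1)] by (simp_all add: J_def N_def)

  have hom: "surjective_cring_hom A Q ((+>\<^bsub>A\<^esub>) J)"
    unfolding Q_def by (rule A.Quot_surjective_cring_hom[OF J])
  have ker: "surjective_cring_hom.preimage A ((+>\<^bsub>A\<^esub>) J) {\<zero>\<^bsub>Q\<^esub>} = J"
    unfolding Q_def by (rule A.Quot_preimage_zero[OF J])
  have "J \<noteq> carrier A"
    using \<open>J \<subseteq> N\<close> \<mu>(3) A.ideal_subset_carrier[OF N] by blast
  then have Q_local: "local_ring Q"
    using surjective_cring_hom.local_ring_image(1)[OF hom A.local_ring_axioms] ker by simp
  interpret Q: local_ring Q by (rule Q_local)
  interpret h: surjective_cring_hom A Q "(+>\<^bsub>A\<^esub>) J" by (rule hom)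
  let ?h = "(+>\<^bsub>A\<^esub>) J"
  have pre_m: "h.preimage (max_ideal Q) = ?m"
    using h.local_ring_image(2)[OF A.local_ring_axioms] ker \<open>J \<noteq> carrier A\<close> by simp

  have nil_iff: "?h a \<in> nilradical Q \<longleftrightarrow> a \<in> N" if a: "a \<in> carrier A" for a
  proof
    assume "?h a \<in> nilradical Q"
    then obtain k :: nat where "a [^]\<^bsub>A\<^esub> k \<in> N"
      using h.mem_nilradical_iff[OF a] ker \<open>J \<subseteq> N\<close> by auto
    then show "a \<in> N"
      using assms(6) a unfolding radical_ideal_def ideal_radical_def N_def by blast
  next
    assume "a \<in> N"
    then show "?h a \<in> nilradical Q"
      using A.nil_mod_powers[OF \<mu>(1) len_n, of a] h.mem_nilradical_iff[OF a] ker
      by (simp add: N_def J_def \<nu>_def)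
  qed
  have nil_carrier: "nilradical Q \<subseteq> carrier Q"
    by (auto simp: nilradical_def ideal_radical_def)
  have pre_nil: "h.preimage (nilradical Q) = N"
    using nil_iff A.ideal_subset_carrier[OF N] by (auto simp: h.preimage_def)
  then have nil: "ideal (nilradical Q) Q"
    using h.image_ideal[OF N] h.image_preimage[OF nil_carrier] by simp

  have "saturation Q I <+>\<^bsub>Q\<^esub> nilradical Q = saturation Q (I <+>\<^bsub>Q\<^esub> nilradical Q)"
    if ci: "complete_intersection_ideal Q I" for I
  proof -
    obtain xs where xs: "xs \<noteq> []" "regular_sequence Q xs" "I = Idl\<^bsub>Q\<^esub> (set xs)"
      using ci by (auto simp: complete_intersection_ideal_def)
    then have xs': "set xs \<subseteq> carrier Q" "weakly_regular Q {\<zero>\<^bsub>Q\<^esub>} xs" "I \<noteq> carrier Q"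
      by (auto simp: Q.regular_sequence_iff)
    have I: "ideal I Q"
      unfolding xs(3) by (rule Q.genideal_ideal[OF xs'(1)])
    have I_sub: "I \<subseteq> I <+>\<^bsub>Q\<^esub> nilradical Q"
      using Q.genideal_self[of "I \<union> nilradical Q"] Q.ideal_subset_carrier[OF I] nil_carrier
      unfolding Q.union_genideal[OF I nil] by blast
    obtain ys where ys: "set ys \<subseteq> carrier A" "xs = map ?h ys"
      by (rule h.lift_list[OF xs'(1)])
    have "weakly_regular A J ys"
      using h.weakly_regular_preimage_iff[OF Q.zeroideal ys(1)] xs'(2) ys(2) ker by simp
    moreover have "weakly_regular A {\<zero>\<^bsub>A\<^esub>} \<nu>"
      using A.weakly_regular_pow_append[OF A.zeroideal, of \<mu> "[]" n] \<mu>(2) len_n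
      by (simp add: \<nu>_def)
    ultimately have \<nu>ys: "weakly_regular A {\<zero>\<^bsub>A\<^esub>} (\<nu> @ ys)"
      using A.weakly_regular_append[OF A.zeroideal \<nu>(1)] J_zero by simp
    have pre_I: "ideal (h.preimage I) A" "J \<subseteq> h.preimage I"
      using h.preimage_ideal[OF I] h.preimage_zero_subset[OF I] ker by simp_all
    have ys_I: "set ys \<subseteq> h.preimage I"
      using Q.genideal_self[OF xs'(1)] ys by (auto simp: xs(3) h.preimage_def)
    show ?thesis
    proof (cases "length ys = 1")
      case True
      then obtain y where y: "ys = [y]"
        by (cases ys) auto
      have yc: "y \<in> carrier A" using ys(1) y by simp
      have I_eq: "I = Idl\<^bsub>Q\<^esub> {?h y}"
        using xs(3) ys(2) y by simp
      have "h.preimage I \<noteq> carrier A"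
        using h.preimage_eq_iff[OF Q.ideal_subset_carrier[OF I] order_refl] h.preimage_carrier xs'(3)
        by simp
      then have "y \<in> ?m"
        using A.proper_ideal_subset_max_ideal[OF pre_I(1)] ys_I y by auto
      \<comment> \<open>pass from the powers to the \<open>\<mu>\<^sub>i\<close>, extend there, and return to the powers\<close>
      have "regular_mod A (Idl\<^bsub>A\<^esub> ({\<zero>\<^bsub>A\<^esub>} \<union> set \<nu>)) y"
        using A.weakly_regular_append[OF A.zeroideal \<nu>(1), of ys] \<nu>ys y by simp
      then have "regular_mod A (Idl\<^bsub>A\<^esub> ({\<zero>\<^bsub>A\<^esub>} \<union> set \<mu>)) y"
        unfolding \<nu>_def by (rule A.regular_mod_adjoin_roots[OF A.zeroideal \<mu>(2) len_n n0])
      then have \<mu>y: "weakly_regular A {\<zero>\<^bsub>A\<^esub>} (\<mu> @ [y])"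
        using A.weakly_regular_append[OF A.zeroideal \<mu>(1)] \<mu>(2) by simp
      have \<mu>y_m: "set (\<mu> @ [y]) \<subseteq> ?m"
        using \<mu>N \<open>N \<subseteq> ?m\<close> \<open>y \<in> ?m\<close> by auto
      have "depth A = enat d" "d - 1 < d"
        using assms(1-3) by (simp_all add: cohen_macaulay_local_ring_def)
      then obtain zs where zs: "regular_sequence A zs" "set zs \<subseteq> ?m" "d - 1 < length zs"
        by (rule long_regular_sequence_if_depth)
      have "\<exists>z\<in>?m. regular_mod A (Idl\<^bsub>A\<^esub> ({\<zero>\<^bsub>A\<^esub>} \<union> set (\<mu> @ [y]))) z"
      proof (rule A.weakly_regular_extend[OF A.zeroideal A.max_ideal_ideal \<mu>y \<mu>y_m _ zs(2)])
        show "weakly_regular A {\<zero>\<^bsub>A\<^esub>} zs"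
          using zs(1) by (simp add: A.regular_sequence_iff)
        show "length (\<mu> @ [y]) < length zs"
          using zs(3) assms(3,4) by simp
      qed
      then obtain z where z: "z \<in> ?m"
        "regular_mod A (Idl\<^bsub>A\<^esub> ({\<zero>\<^bsub>A\<^esub>} \<union> set (\<mu> @ [y]))) z" by blast
      have "weakly_regular A {\<zero>\<^bsub>A\<^esub>} ((\<mu> @ [y]) @ [z])"
        using A.weakly_regular_append[OF A.zeroideal weakly_regular_in_carrier[OF \<mu>y], of "[z]"]
          \<mu>y z(2) by simp
      then have "weakly_regular A {\<zero>\<^bsub>A\<^esub>} (\<nu> @ [y, z])"
        using A.weakly_regular_pow_append[OF A.zeroideal, of \<mu> "[y, z]" n] len_n
        by (simp add: \<nu>_def)
      then have z_J: "regular_mod A (Idl\<^bsub>A\<^esub> (insert y J)) z"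
        using A.weakly_regular_append[OF A.zeroideal \<nu>(1), of "[y, z]"] J_zero by simp
      have z_N: "regular_mod A (Idl\<^bsub>A\<^esub> (insert y N)) z"
        using z(2) A.adjoin_Idl_Un[OF A.zeroideal yc \<mu>(1)] N_zero by simp
      have zc: "z \<in> carrier A" using regular_mod_carrier[OF z_N] .
      have hz: "?h z \<in> max_ideal Q"
        using z(1) pre_m zc h.preimage_mem_iff by blast
      have hy: "?h y \<in> carrier Q" using yc by simp
      have "h.preimage I = Idl\<^bsub>A\<^esub> (insert y J)"
        using h.preimage_adjoin[OF Q.zeroideal yc] Q.Idl_insert_zero[of "{?h y}"] hy ker
        by (simp add: I_eq insert_commute)
      then have "regular_mod Q I (?h z)"
        using h.regular_mod_preimage_iff[OF zc] z_J by simp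
      then have sat_I: "saturation Q I = I"
        by (rule Q.saturation_eq_self[OF I hz])
      have "I <+>\<^bsub>Q\<^esub> nilradical Q = Idl\<^bsub>Q\<^esub> (insert (?h y) (nilradical Q))"
        using Q.union_genideal[OF I nil] Q.Idl_Un_Idl[of "{?h y}" "nilradical Q"] hy nil_carrier
        by (simp add: I_eq)
      then have "regular_mod Q (I <+>\<^bsub>Q\<^esub> nilradical Q) (?h z)"
        using h.regular_mod_preimage_iff[OF zc] h.preimage_adjoin[OF nil yc] pre_nil z_N by simp
      then have "saturation Q (I <+>\<^bsub>Q\<^esub> nilradical Q) = I <+>\<^bsub>Q\<^esub> nilradical Q"
        by (rule Q.saturation_eq_self[OF Q.add_ideals[OF I nil] hz])
      then show ?thesis
        by (simp add: sat_I)
    next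
      case False
      then have len: "2 \<le> length ys"
        using xs(1) ys(2) by (cases ys) (auto simp: Suc_le_eq)
      have "saturation Q I = carrier Q"
      proof (rule Q.saturation_eq_carrier[OF I])
        fix P assume P: "primeideal P Q" "I \<subseteq> P"
        have Pc: "P \<subseteq> carrier Q"
          using Q.ideal_subset_carrier primeideal.axioms(1)[OF P(1)] by blast
        have "h.preimage I \<subseteq> h.preimage P"
          using P(2) by (auto simp: h.preimage_def)
        then have "set (\<nu> @ ys) \<subseteq> h.preimage P"
          using ys_I pre_I(2) A.genideal_self[OF \<nu>(1)] by (auto simp: J_def)
        then have "h.preimage P = ?m"
          using A.regular_length_less_krull_dim[OF \<nu>ys h.preimage_prime[OF P(1)]] len \<nu>(2)
            assms(2,3) by fastforce
        then show "P = max_ideal Q"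
          using h.preimage_eq_iff[OF Pc Q.ideal_subset_carrier[OF Q.max_ideal_ideal]] pre_m by simp
      qed
      moreover have "carrier Q <+>\<^bsub>Q\<^esub> nilradical Q = carrier Q"
        using Q.union_genideal[OF Q.oneideal nil] nil_carrier Q.Idl_ideal_eq[OF Q.oneideal]
        by (simp add: Un_absorb2)
      moreover have "saturation Q I \<subseteq> saturation Q (I <+>\<^bsub>Q\<^esub> nilradical Q)"
        by (rule Q.saturation_mono[OF I_sub])
      ultimately show ?thesis
        using Q.saturation_in_carrier[of "I <+>\<^bsub>Q\<^esub> nilradical Q"] by auto
    qed
  qed
  then have "weakly_reduced Q"
    using Q_local by (simp add: weakly_reduced_def)
  then show ?thesis
    by (simp add: Q_def J_def \<nu>_def)
qed

end
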